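(* Let $s\in\mathbb N$ and $f\in C^\infty([0,1]^s)$ satisfy $$\|f^{|\boldsymbol\kappa|}\|_1\le K_2\alpha^{\|\boldsymbol\kappa\|_0}\prod_{j\in J}(|\kappa_j|)!\quad\text{for all }\boldsymbol k\in\mathbb N_0^s,$$ for some positive constants $K_2,\alpha$ and some nonempty $J\subseteq\{1,\dots,s\}$. Let $N_m$, $B'_s$ be as in the context, $c'_s=B'_s\sqrt{\lambda/(2s)}$, and $\mathrm{SUM}_{2,m}=\sum_{\boldsymbol k\in\mathbb N_*^s\setminus Q_{N_m}}Z(\boldsymbol k)S(\boldsymbol k)\hat f(\boldsymbol k)$. Then under the complete random design there exist a constant $d_{s,\alpha}$ depending on $s,\alpha$, a constant $D_2$ depending on $s,\alpha,|J|$ and a threshold $\underline m_2$ depending on $s,\alpha,|J|$ such that for all $m\ge\underline m_2$, $$\Pr\Big(|\mathrm{SUM}_{2,m}|\ge K_22^{-N_m+(2|J|\log_2(m)+D_2)\sqrt{\lambda N_m/s}}\Big)\le m^{d_{s,\alpha}}\exp\Big(-c'_s\frac{m}{\log_2(m)^2}\Big).$$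
   Context: Binary digits: for $k\in\mathbb N_0$, $k=\sum_{\ell\ge1}a_\ell2^{\ell-1}$, $\vec k=(a_1,a_2,\dots)$, $\kappa=\{\ell:a_\ell=1\}$; $\vec x$ the binary digits of $x\in[0,1)$ (expansion not ending in infinitely many 1's). For $\boldsymbol k\in\mathbb N_0^s$ with digit sets $\boldsymbol\kappa=(\kappa_1,\dots,\kappa_s)$, $\|\boldsymbol\kappa\|_1=\sum_j\sum_{\ell\in\kappa_j}\ell$, $\|\boldsymbol\kappa\|_0=\sum_j|\kappa_j|$; $\mathbb N_*^s=\mathbb N_0^s\setminus\{\boldsymbol0\}$, $Q_N=\{\boldsymbol k\in\mathbb N_*^s:\|\boldsymbol\kappa\|_1\le N\}$; $\hat f(\boldsymbol k)=\int f(\boldsymbol x)(-1)^{\sum_j\vec k_j^{\mathsf T}\vec x_j}\mathrm d\boldsymbol x$; $f^{|\boldsymbol\kappa|}=\partial^{\|\boldsymbol\kappa\|_0}f/\partial x_1^{|\kappa_1|}\cdots\partial x_s^{|\kappa_s|}$; $\|\cdot\|_1$ the $L^1$ norm. $\oplus$ is componentwise bitwise XOR on $\mathbb N_0^s$; $\lambda=3(\log2)^2/\pi^2$. Constants: $A_s,B_s>0$ depend only on $s$ and satisfy: for all $N\ge1$, $r\ge2$, if $\boldsymbol k_1,\dots,\boldsymbol k_r$ are i.i.d. uniform on $Q_N$ then $\Pr(\oplus_i\boldsymbol k_i\in Q_N)\le A_s^rN^{r/4}r^{-B_s\sqrt N}$; $c_s=\frac14B_s\sqrt{\lambda/s}$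 and $N_m=\sup\{N\in\mathbb N_0:|Q_N|\le c_sm2^m\}$. $A'_s,B'_s>0$ depend only on $s$ and satisfy: for all $N\ge1$, $j\in\{1,\dots,s\}$, $\epsilon\in(0,1)$, if $\boldsymbol k$ is uniform on $Q_N$ then $\Pr\big(\big||\kappa_j|/\sqrt{\lambda N/s}-2\big|>\epsilon\big)\le A'_sN^{1/4}\exp(-B'_s\epsilon^2\sqrt N)$. Complete random design: random $C_j\in\{0,1\}^{\infty\times m}$ ($j=1,\dots,s$) with all entries i.i.d. uniform on $\{0,1\}$, and digital shifts $\vec D_j\in\{0,1\}^\infty$ with i.i.d. uniform entries independent of the $C_j$. $Z(\boldsymbol k)=\mathbf 1\{\sum_j\sum_{\ell\in\kappa_j}C_j(\ell,:)=\boldsymbol0\bmod2\}$, $S(\boldsymbol k)=(-1)^{\sum_j\vec k_j^{\mathsf T}\vec D_j}$. *)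

theory Defs
  imports "HOL-Probability.Probability"
begin

text \<open>Conventions: dimension s; coordinates indexed 0..s-1 (paper's j=1..s).
  Points of [0,1]^s are extensional functions nat => real on {..<s}.
  Integer vectors k in N_0^s are functions nat => nat vanishing at indices >= s.\<close>

definition lam :: real where "lam = 3 * (ln 2)^2 / pi^2"

definition kappa :: "nat \<Rightarrow> nat set" where
  "kappa k = {l. 1 \<le> l \<and> bit k (l - 1)}"

text \<open>l-th binary digit (l >= 1) of x in [0,1), expansion not ending in 1's.\<close>
definition xdig :: "nat \<Rightarrow> real \<Rightarrow> nat" where
  "xdig l x = nat \<lfloor>2 ^ l * x\<rfloor> mod 2"

definition vecs :: "nat \<Rightarrow> (nat \<Rightarrow> nat) set" where
  "vecs s = {k. \<forall>j\<ge>s. k j = 0}"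

definition norm1 :: "nat \<Rightarrow> (nat \<Rightarrow> nat) \<Rightarrow> nat" where
  "norm1 s k = (\<Sum>j<s. \<Sum>l\<in>kappa (k j). l)"

definition norm0 :: "nat \<Rightarrow> (nat \<Rightarrow> nat) \<Rightarrow> nat" where
  "norm0 s k = (\<Sum>j<s. card (kappa (k j)))"

definition QN :: "nat \<Rightarrow> nat \<Rightarrow> (nat \<Rightarrow> nat) set" where
  "QN s N = {k \<in> vecs s. k \<noteq> (\<lambda>_. 0) \<and> norm1 s k \<le> N}"

definition vxor :: "(nat \<Rightarrow> nat) \<Rightarrow> (nat \<Rightarrow> nat) \<Rightarrow> nat \<Rightarrow> nat" where
  "vxor k1 k2 = (\<lambda>j. xor (k1 j) (k2 j))"

definition bigxor :: "(nat \<Rightarrow> nat) list \<Rightarrow> nat \<Rightarrow> nat" where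
  "bigxor ks = foldr vxor ks (\<lambda>_. 0)"

definition cube :: "nat \<Rightarrow> (nat \<Rightarrow> real) set" where
  "cube s = PiE {..<s} (\<lambda>_. {0..1::real})"

definition cubeM :: "nat \<Rightarrow> (nat \<Rightarrow> real) measure" where
  "cubeM s = PiM {..<s} (\<lambda>_. restrict_space lborel {0..1::real})"

definition walsh :: "nat \<Rightarrow> (nat \<Rightarrow> nat) \<Rightarrow> (nat \<Rightarrow> real) \<Rightarrow> real" where
  "walsh s k x = (-1::real) ^ (\<Sum>j<s. \<Sum>l\<in>kappa (k j). xdig l (x j))"

definition fhat :: "nat \<Rightarrow> ((nat \<Rightarrow> real) \<Rightarrow> real) \<Rightarrow> (nat \<Rightarrow> nat) \<Rightarrow> real" where
  "fhat s f k = (LINT x | cubeM s. f x * walsh s k x)"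

definition partial :: "nat \<Rightarrow> ((nat \<Rightarrow> real) \<Rightarrow> real) \<Rightarrow> (nat \<Rightarrow> real) \<Rightarrow> real" where
  "partial j g x = (SOME D. ((\<lambda>t. g (x(j := t))) has_real_derivative D) (at (x j) within {0..1}))"

definition iter_partial :: "nat list \<Rightarrow> ((nat \<Rightarrow> real) \<Rightarrow> real) \<Rightarrow> (nat \<Rightarrow> real) \<Rightarrow> real" where
  "iter_partial js g = foldr partial js g"

definition smooth_cube :: "nat \<Rightarrow> ((nat \<Rightarrow> real) \<Rightarrow> real) \<Rightarrow> bool" where
  "smooth_cube s g \<longleftrightarrow>
    (\<forall>js. set js \<subseteq> {..<s} \<longrightarrow>
       continuous_on (cube s) (iter_partial js g) \<and>
       (\<forall>x\<in>cube s. \<forall>j<s. \<exists>D. ((\<lambda>t. iter_partial js g (x(j := t))) has_real_derivative D)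
                               (at (x j) within {0..1})))"

definition mixed :: "nat \<Rightarrow> (nat \<Rightarrow> nat) \<Rightarrow> ((nat \<Rightarrow> real) \<Rightarrow> real) \<Rightarrow> (nat \<Rightarrow> real) \<Rightarrow> real" where
  "mixed s a g = foldr (\<lambda>j h. (partial j ^^ a j) h) [0..<s] g"

text \<open>Hypothesis on (A_s, B_s): i.i.d. uniform k_1..k_r on Q_N, probability written as counting.\<close>
definition AB_hyp :: "nat \<Rightarrow> real \<Rightarrow> real \<Rightarrow> bool" where
  "AB_hyp s A B \<longleftrightarrow> 0 < A \<and> 0 < B \<and>
    (\<forall>N::nat. \<forall>r::nat. 1 \<le> N \<longrightarrow> 2 \<le> r \<longrightarrow>
      real (card {ks. length ks = r \<and> set ks \<subseteq> QN s N \<and> bigxor ks \<in> QN s N})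
        / real (card (QN s N)) ^ r
      \<le> A ^ r * real N powr (real r / 4) * real r powr (- B * sqrt (real N)))"

definition AB'_hyp :: "nat \<Rightarrow> real \<Rightarrow> real \<Rightarrow> bool" where
  "AB'_hyp s A' B' \<longleftrightarrow> 0 < A' \<and> 0 < B' \<and>
    (\<forall>N::nat. \<forall>j<s. \<forall>\<epsilon>::real. 1 \<le> N \<longrightarrow> 0 < \<epsilon> \<longrightarrow> \<epsilon> < 1 \<longrightarrow>
      real (card {k \<in> QN s N.
               \<bar>real (card (kappa (k j))) / sqrt (lam * real N / real s) - 2\<bar> > \<epsilon>})
        / real (card (QN s N))
      \<le> A' * real N powr (1/4) * exp (- B' * \<epsilon>^2 * sqrt (real N)))"

definition c_s :: "nat \<Rightarrow> real \<Rightarrow> real" where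
  "c_s s B = B / 4 * sqrt (lam / real s)"

definition Nm :: "nat \<Rightarrow> real \<Rightarrow> nat \<Rightarrow> nat" where
  "Nm s B m = Sup {N. real (card (QN s N)) \<le> c_s s B * real m * 2 ^ m}"

text \<open>Complete random design: coin Inl (j,l,c) = C_j(l,c), coin Inr (j,l) = D_j(l),
  all i.i.d. uniform on {0,1} (= bool). Unused coins are harmless.\<close>
type_synonym design_idx = "(nat \<times> nat \<times> nat) + (nat \<times> nat)"

definition designM :: "(design_idx \<Rightarrow> bool) measure" where
  "designM = PiM UNIV (\<lambda>_. measure_pmf (bernoulli_pmf (1/2)))"

definition Zd :: "nat \<Rightarrow> nat \<Rightarrow> (nat \<Rightarrow> nat) \<Rightarrow> (design_idx \<Rightarrow> bool) \<Rightarrow> real" where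
  "Zd s m k \<omega> = (if \<forall>c<m. even (card {(j, l). j < s \<and> l \<in> kappa (k j) \<and> \<omega> (Inl (j, l, c))})
                 then 1 else 0)"

definition Sd :: "nat \<Rightarrow> (nat \<Rightarrow> nat) \<Rightarrow> (design_idx \<Rightarrow> bool) \<Rightarrow> real" where
  "Sd s k \<omega> = (-1) ^ card {(j, l). j < s \<and> l \<in> kappa (k j) \<and> \<omega> (Inr (j, l))}"

definition SUM2 :: "nat \<Rightarrow> real \<Rightarrow> nat \<Rightarrow> ((nat \<Rightarrow> real) \<Rightarrow> real) \<Rightarrow> (design_idx \<Rightarrow> bool) \<Rightarrow> real" where
  "SUM2 s B m f \<omega> = (\<Sum>\<^sub>\<infinity>k \<in> {k \<in> vecs s. k \<noteq> (\<lambda>_. 0)} - QN s (Nm s B m).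
                        Zd s m k \<omega> * Sd s k \<omega> * fhat s f k)"

end

theory Submission
  imports Defs "HOL-Real_Asymp.Real_Asymp"
begin

text \<open>
  Integrating by parts once per binary digit gives
  \<open>|fhat f k| \<le> 2^(-\<parallel>\<kappa>\<parallel>\<^sub>1) \<parallel>f^(|\<kappa>|)\<parallel>\<^sub>1\<close>. Write \<open>N = N_m\<close>, \<open>T = sqrt (\<lambda> N / s)\<close> and
  \<open>L = log\<^sub>2 m\<close>, and let \<open>N'\<close> exceed \<open>N\<close> by a large multiple of \<open>m L\<close>. Beyond \<open>N'\<close> the factor
  \<open>2^(-\<parallel>\<kappa>\<parallel>\<^sub>1)\<close> beats both the number of terms and the growth of the derivatives, so that part of the
  sum is \<open>O(2^(-N))\<close> for every design. Halving all coordinates of \<open>k\<close> lowers \<open>\<parallel>\<kappa>\<parallel>\<^sub>1\<close> by \<open>\<parallel>\<kappa>\<parallel>\<^sub>0\<close>,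
  which is typically at least \<open>T\<close>; hence adding \<open>T\<close> to the radius multiplies \<open>|Q|\<close> by at most a
  constant, and \<open>|Q_N'|\<close> is at most \<open>2^m\<close> times a power of \<open>m\<close>. Each \<open>k\<close> survives with probability
  \<open>2^(-m)\<close>, so with the claimed probability no \<open>k\<close> in \<open>Q_N'\<close> having some
  \<open>\<bar>|\<kappa>_j| - 2 T'\<bar> > T' / L\<close>, where \<open>T' = sqrt (\<lambda> N' / s)\<close>, survives. The other \<open>k\<close> between the two
  radii carry factorials of size at most \<open>2^(|J| (2 L + O(1)) T)\<close>, and their number is absorbed by
  the constant \<open>D\<^sub>2\<close> because \<open>m = O(T)\<close>.
\<close>

section \<open>Walsh coefficients of smooth functions\<close>

lemma kappa_0 [simp]: "kappa 0 = {}"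
  by (simp add: kappa_def)

text \<open>Dropping the lowest binary digit moves every other digit down by one position. All
  inductions over digit sets below run along \<open>k div 2\<close>.\<close>

lemma kappa_div2: "kappa k = (if odd k then {1} else {}) \<union> Suc ` kappa (k div 2)"
proof (intro set_eqI iffI)
  fix l assume l: "l \<in> kappa k"
  then obtain i where i: "l = Suc i" "bit k i" by (cases l) (auto simp: kappa_def)
  show "l \<in> (if odd k then {1} else {}) \<union> Suc ` kappa (k div 2)"
  proof (cases i)
    case 0 with i show ?thesis by (auto simp: bit_0)
  next
    case (Suc i') with i show ?thesis by (auto simp: bit_Suc kappa_def)
  qed
next
  fix l assume "l \<in> (if odd k then {1} else {}) \<union> Suc ` kappa (k div 2)"
  then show "l \<in> kappa k"
    by (auto simp: kappa_def bit_0 split: if_splits) (metis One_nat_def Suc_le_D bit_Suc diff_Suc_1)+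
qed

lemma finite_kappa [simp]: "finite (kappa k)"
proof (induction k rule: less_induct)
  case (less k)
  show ?case
  proof (cases "k = 0")
    case False
    then have "k div 2 < k" by simp
    from less.IH[OF this] show ?thesis by (subst kappa_div2) simp
  qed simp
qed

lemma kappa_pos: "l \<in> kappa k \<Longrightarrow> 1 \<le> l"
  by (simp add: kappa_def)

lemma sum_kappa_div2:
  "sum f (kappa k) = (if odd k then f 1 else 0) + (\<Sum>l\<in>kappa (k div 2). f (Suc l))"
proof -
  have d: "(if odd k then {1} else {}) \<inter> Suc ` kappa (k div 2) = {}"
    by (auto dest: kappa_pos)
  have "sum f (kappa k) = sum f ((if odd k then {1} else {}) \<union> Suc ` kappa (k div 2))"
    by (subst kappa_div2) simp
  also have "\<dots> = sum f (if odd k then {1} else {}) + sum f (Suc ` kappa (k div 2))"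
    by (rule sum.union_disjoint) (auto simp: d)
  also have "sum f (Suc ` kappa (k div 2)) = (\<Sum>l\<in>kappa (k div 2). f (Suc l))"
    by (simp add: sum.reindex)
  finally show ?thesis by simp
qed

lemma card_kappa_div2: "card (kappa k) = (if odd k then 1 else 0) + card (kappa (k div 2))"
  using sum_kappa_div2[of "\<lambda>_. 1::nat" k] by simp

lemma sum_id_kappa_div2:
  "\<Sum>(kappa k) = (if odd k then 1 else 0) + \<Sum>(kappa (k div 2)) + card (kappa (k div 2))"
  using sum_kappa_div2[of "\<lambda>l. l" k] by (simp add: sum_Suc)

section \<open>One-dimensional Walsh functions (in Paley order) and their kernels\<close>

definition wal1 :: "nat \<Rightarrow> real \<Rightarrow> real" where
  "wal1 k x = (-1) ^ (\<Sum>l\<in>kappa k. xdig l x)"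

lemma wal1_0 [simp]: "wal1 0 x = 1"
  by (simp add: wal1_def)

lemma wal1_left:
  assumes "0 \<le> x" "x < 1/2"
  shows "wal1 k x = wal1 (k div 2) (2 * x)"
proof -
  have "xdig 1 x = 0"
  proof -
    have "\<lfloor>2 * x\<rfloor> = 0" using assms by (simp add: floor_eq_iff)
    then show ?thesis by (simp add: xdig_def)
  qed
  moreover have "xdig (Suc l) x = xdig l (2 * x)" for l by (simp add: xdig_def mult_ac)
  ultimately show ?thesis unfolding wal1_def by (subst sum_kappa_div2) simp
qed

lemma wal1_right:
  assumes "1/2 \<le> x" "x < 1"
  shows "wal1 k x = (if odd k then - 1 else 1) * wal1 (k div 2) (2 * x - 1)"
proof -
  have 1: "xdig 1 x = 1"
  proof -
    have "\<lfloor>2 * x\<rfloor> = 1" using assms by (simp add: floor_eq_iff)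
    then show ?thesis by (simp add: xdig_def)
  qed
  have 2: "xdig (Suc l) x = xdig l (2 * x - 1)" if l: "l \<in> kappa (k div 2)" for l
  proof -
    \<comment> \<open>Positions start at 1, so \<open>2 ^ l\<close> is even. The leading digit 1 of
      \<open>x\<close> adds exactly this amount to the floor and leaves the parity alone.\<close>
    obtain i where i: "l = Suc i" using kappa_pos[OF l] by (cases l) auto
    have "\<lfloor>2 ^ Suc l * x\<rfloor> = \<lfloor>2 ^ l * (2 * x - 1) + of_int (2 ^ l)\<rfloor>"
      by (simp add: algebra_simps)
    then have e: "\<lfloor>2 ^ Suc l * x\<rfloor> = \<lfloor>2 ^ l * (2 * x - 1)\<rfloor> + 2 ^ l"
      by (simp only: floor_add_int [symmetric])
    have "0 \<le> \<lfloor>2 ^ l * (2 * x - 1)\<rfloor>" using assms by simp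
    then have "nat \<lfloor>2 ^ Suc l * x\<rfloor> = nat \<lfloor>2 ^ l * (2 * x - 1)\<rfloor> + 2 ^ l"
      using e by (simp add: nat_add_distrib nat_power_eq)
    then show ?thesis unfolding xdig_def i by simp
  qed
  show ?thesis unfolding wal1_def by (subst sum_kappa_div2) (simp add: 1 [simplified] 2 power_add)
qed

text \<open>Each half is an affine copy of the unit interval at scale 1/2. Nothing is asked of
  \<open>F\<close> at 1/2 and 1, a null set; at the endpoint 1 the recursion for \<open>wal1\<close>
  does not apply.\<close>

lemma has_integral_glue_halves:
  fixes F u v :: "real \<Rightarrow> real"
  assumes u: "(u has_integral a) {0..1}" and v: "(v has_integral b) {0..1}"
    and l: "\<And>x. 0 \<le> x \<Longrightarrow> x < 1/2 \<Longrightarrow> F x = u (2 * x)"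
    and r: "\<And>x. 1/2 < x \<Longrightarrow> x < 1 \<Longrightarrow> F x = v (2 * x - 1)"
  shows "(F has_integral (a + b) / 2) {0..1}"
proof -
  have "((\<lambda>x. u (2 *\<^sub>R x + 0)) has_integral (a /\<^sub>R \<bar>2\<bar> ^ DIM(real))) ((\<lambda>x. x /\<^sub>R 2 + - (0 /\<^sub>R 2)) ` cbox 0 1)"
    using has_integral_affinity[of u a 0 1 2 0] u by simp
  moreover have "(\<lambda>x::real. x /\<^sub>R 2 + - (0 /\<^sub>R 2)) ` cbox 0 1 = {0..1/2}"
    by (subst image_affinity_cbox) auto
  ultimately have "((\<lambda>x. u (2 * x)) has_integral a / 2) {0..1/2}" by simp
  then have 1: "(F has_integral a / 2) {0..1/2}"
    by (rule has_integral_spike_finite[where S="{1/2}", rotated 2]) (auto simp: l)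
  have "((\<lambda>x. v (2 *\<^sub>R x + (-1))) has_integral (b /\<^sub>R \<bar>2\<bar> ^ DIM(real))) ((\<lambda>x. x /\<^sub>R 2 + - ((-1) /\<^sub>R 2)) ` cbox 0 1)"
    using has_integral_affinity[of v b 0 1 2 "-1"] v by simp
  moreover have "(\<lambda>x::real. x /\<^sub>R 2 + - ((-1) /\<^sub>R 2)) ` cbox 0 1 = {1/2..1}"
    by (subst image_affinity_cbox) auto
  ultimately have "((\<lambda>x. v (2 * x - 1)) has_integral b / 2) {1/2..1}" by simp
  then have 2: "(F has_integral b / 2) {1/2..1}"
    by (rule has_integral_spike_finite[where S="{1/2,1}", rotated 2]) (auto simp: r)
  have "(F has_integral (a / 2 + b / 2)) {0..1}"
    by (rule has_integral_combine[OF _ _ 1 2]) auto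
  then show ?thesis by (simp add: add_divide_distrib)
qed

text \<open>Self-similarity under \<open>x \<mapsto> 2x\<close> reduces \<open>k\<close> to \<open>k div 2\<close>; an odd \<open>k\<close> costs one
  integration by parts, whose boundary terms cancel.\<close>

lemma walsh_kernel_exists:
  "\<exists>K. continuous_on {0..1} K \<and> K 0 = K 1 \<and> (\<forall>x\<in>{0..1}. \<bar>K x\<bar> \<le> (1/2) ^ \<Sum>(kappa k)) \<and>
     (\<forall>g :: nat \<Rightarrow> real \<Rightarrow> real.
        (\<forall>i<card (kappa k). \<forall>x\<in>{0..1}. (g i has_real_derivative g (Suc i) x) (at x within {0..1})) \<longrightarrow>
        continuous_on {0..1} (g (card (kappa k))) \<longrightarrow>
        ((\<lambda>x. g 0 x * wal1 k x) has_integral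
           integral {0..1} (\<lambda>x. g (card (kappa k)) x * K x)) {0..1})"
proof (induction k rule: less_induct)
  case (less k)
  show ?case
  proof (cases "k = 0")
    case True
    show ?thesis
      by (rule exI[of _ "\<lambda>_. 1"]) (auto simp: True intro!: integrable_integral integrable_continuous_interval)
  next
    case False
    define k' n where "k' = k div 2" and "n = card (kappa k')"
    from False have "k' < k" by (simp add: k'_def)
    from less.IH[OF this] obtain K where K: "continuous_on {0..1} K" "K 0 = K 1"
      "\<And>x. x \<in> {0..1} \<Longrightarrow> \<bar>K x\<bar> \<le> (1/2) ^ \<Sum>(kappa k')"
      and Kg: "\<And>g :: nat \<Rightarrow> real \<Rightarrow> real.
        (\<And>i x. i < n \<Longrightarrow> x \<in> {0..1} \<Longrightarrow> (g i has_real_derivative g (Suc i) x) (at x within {0..1})) \<Longrightarrow>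
        continuous_on {0..1} (g n) \<Longrightarrow>
        ((\<lambda>x. g 0 x * wal1 k' x) has_integral integral {0..1} (\<lambda>x. g n x * K x)) {0..1}"
      unfolding n_def[symmetric] by auto
    define e where "e = (if odd k then 1 else 0 :: nat)"
    have ck: "card (kappa k) = n + e" and sk: "\<Sum>(kappa k) = \<Sum>(kappa k') + n + e"
      unfolding k'_def n_def e_def by (simp_all add: card_kappa_div2[of k] sum_id_kappa_div2[of k])
    \<comment> \<open>On either half, \<open>wal1 k\<close> is a rescaled copy of
      \<open>wal1 k'\<close> up to sign. The rescaled functions again form a chain of derivatives,
      the i-th gaining the factor \<open>(1/2)^i\<close>, so the induction hypothesis applies to
      both.\<close>
    have halves: "((\<lambda>x. g 0 x * wal1 k x) has_integral
        (integral {0..1} (\<lambda>y. (1/2)^n * g n (y/2) * K y) +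
         (if odd k then -1 else 1) * integral {0..1} (\<lambda>y. (1/2)^n * g n (y/2 + 1/2) * K y)) / 2) {0..1}"
      if g: "\<And>i x. i < n \<Longrightarrow> x \<in> {0..1} \<Longrightarrow> (g i has_real_derivative g (Suc i) x) (at x within {0..1})"
        and gc: "continuous_on {0..1} (g n)" for g :: "nat \<Rightarrow> real \<Rightarrow> real"
    proof -
      have aff: "((\<lambda>y. (1/2)^0 * g 0 (y/2 + t) * wal1 k' y) has_integral
          integral {0..1} (\<lambda>y. (1/2)^n * g n (y/2 + t) * K y)) {0..1}" if t: "t = 0 \<or> t = 1/2" for t
      proof (rule Kg[of "\<lambda>i y. (1/2)^i * g i (y/2 + t)"])
        fix i and y :: real assume i: "i < n" and y: "y \<in> {0..1}"
        have sub: "(\<lambda>y. y/2 + t) ` {0..1} \<subseteq> {0..1}" using t by auto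
        have "(g i has_real_derivative g (Suc i) (y/2+t)) (at (y/2+t) within (\<lambda>y. y/2 + t) ` {0..1})"
          by (rule has_field_derivative_subset[OF g[OF i] sub]) (use t y in auto)
        then have "((g i \<circ> (\<lambda>y. y/2+t)) has_real_derivative g (Suc i) (y/2+t) * (1/2)) (at y within {0..1})"
          by (rule DERIV_image_chain) (auto intro!: derivative_eq_intros)
        then show "((\<lambda>y. (1/2)^i * g i (y/2 + t)) has_real_derivative (1/2)^(Suc i) * g (Suc i) (y/2+t)) (at y within {0..1})"
          by (auto intro!: derivative_eq_intros simp: o_def)
      next
        show "continuous_on {0..1} (\<lambda>y. (1/2)^n * g n (y/2 + t))"
          by (intro continuous_intros continuous_on_compose2[OF gc]) (use t in auto)
      qed
      show ?thesis
        by (rule has_integral_glue_halves[OF aff[of 0, simplified] has_integral_mult_right[OF aff[of "1/2"]]])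
          (auto simp: wal1_left wal1_right k'_def diff_divide_distrib)
    qed
    show ?thesis
    proof (cases "odd k")
      case ev: False
      \<comment> \<open>Two shrunken copies of \<open>K\<close> side by side. The invariant
        \<open>K 0 = K 1\<close> is what makes them fit continuously at 1/2.\<close>
      define F where "F x = (1/2)^n * (if x \<le> 1/2 then K (2 * x) else K (2 * x - 1))" for x
      have cF: "continuous_on {0..1} F"
      proof -
        have mid: "K (2 * x) = K (2 * x - 1)" if "x * 2 = 1" for x
        proof -
          have "2 * x = 1" using that by simp
          then show ?thesis by (simp add: K(2))
        qed
        have "continuous_on ({0..1/2} \<union> {1/2..1}) (\<lambda>x. if x \<le> 1/2 then K (2 * x) else K (2 * x - 1))"
          by (rule continuous_on_cases)
             (auto simp: mid intro!: continuous_on_compose2[OF K(1)] continuous_intros)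
        moreover have "{0..1/2} \<union> {1/2..1} = {0..1::real}" by auto
        ultimately show ?thesis unfolding F_def by (intro continuous_intros) simp
      qed
      show ?thesis
      proof (intro exI[of _ F] conjI ballI allI impI cF)
        show "F 0 = F 1" by (simp add: F_def K(2))
        fix x :: real assume x: "x \<in> {0..1}"
        have "\<bar>if x \<le> 1/2 then K (2 * x) else K (2 * x - 1)\<bar> \<le> (1/2) ^ \<Sum>(kappa k')"
          using K(3)[of "2*x"] K(3)[of "2*x-1"] x by auto
        then show "\<bar>F x\<bar> \<le> (1/2) ^ \<Sum>(kappa k)"
          using ev by (simp add: F_def sk e_def power_add abs_mult mult.commute)
      next
        fix g :: "nat \<Rightarrow> real \<Rightarrow> real"
        assume g: "\<forall>i<card (kappa k). \<forall>x\<in>{0..1}. (g i has_real_derivative g (Suc i) x) (at x within {0..1})"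
          and gc: "continuous_on {0..1} (g (card (kappa k)))"
        have ck': "card (kappa k) = n" using ev by (simp add: ck e_def)
        note h = halves[of g]
        have int: "((\<lambda>y. (1/2)^n * g n (y/2 + t) * K y) has_integral
            integral {0..1} (\<lambda>y. (1/2)^n * g n (y/2 + t) * K y)) {0..1}" if t: "t = 0 \<or> t = 1/2" for t
          by (intro integrable_integral integrable_continuous_interval continuous_intros K(1)
              continuous_on_compose2[OF gc[unfolded ck']]) (use t in auto)
        have "((\<lambda>x. g n x * F x) has_integral
            (integral {0..1} (\<lambda>y. (1/2)^n * g n (y/2) * K y) +
             integral {0..1} (\<lambda>y. (1/2)^n * g n (y/2 + 1/2) * K y)) / 2) {0..1}"
          by (rule has_integral_glue_halves[OF int[of 0, simplified] int[of "1/2"]])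
             (auto simp: F_def field_simps)
        note e = integral_unique[OF this]
        have "((\<lambda>x. g 0 x * wal1 k x) has_integral
            (integral {0..1} (\<lambda>y. (1/2)^n * g n (y/2) * K y) +
             integral {0..1} (\<lambda>y. (1/2)^n * g n (y/2 + 1/2) * K y)) / 2) {0..1}"
          using h g gc ev by (simp add: ck')
        then show "((\<lambda>x. g 0 x * wal1 k x) has_integral
           integral {0..1} (\<lambda>x. g (card (kappa k)) x * F x)) {0..1}"
          unfolding ck' e .
      qed
    next
      case od: True
      define M where "M y = integral {0..y} K" for y
      \<comment> \<open>\<open>W / 2\<close> is the antiderivative of the two copies of
        \<open>K\<close> with the right one negated. It vanishes at both ends, so integrating by
        parts leaves no boundary term. The minus sign in \<open>F\<close> and one more factor 1/2
        come from that integration.\<close>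
      define W where "W x = (if x \<le> 1/2 then M (2 * x) else M 1 - M (2 * x - 1))" for x
      define F where "F x = - ((1/2)^(Suc n)) * W x" for x
      have Ki: "K integrable_on {a..b}" if "0 \<le> a" "b \<le> 1" for a b
        by (rule integrable_continuous_interval[OF continuous_on_subset[OF K(1)]]) (use that in auto)
      have dM: "(M has_real_derivative K y) (at y within {0..1})" if "y \<in> {0..1}" for y
        unfolding M_def using integral_has_real_derivative[OF K(1) that] .
      have cM: "continuous_on {0..1} M"
        using dM by (meson DERIV_continuous continuous_on_eq_continuous_within)
      have M0: "M 0 = 0" by (simp add: M_def)
      have Kb: "\<bar>integral {a..b} K\<bar> \<le> (1/2) ^ \<Sum>(kappa k')" if ab: "0 \<le> a" "a \<le> b" "b \<le> 1" for a b
      proof -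
        have "norm (integral {a..b} K) \<le> (1/2) ^ \<Sum>(kappa k') * (b - a)"
          by (rule integral_bound) (use ab K(3) in \<open>auto intro: continuous_on_subset[OF K(1)]\<close>)
        also have "\<dots> \<le> (1/2) ^ \<Sum>(kappa k') * 1" using ab by (intro mult_left_mono) auto
        finally show ?thesis by simp
      qed
      have M1: "M 1 - M y = integral {y..1} K" if "y \<in> {0..1}" for y
        using Henstock_Kurzweil_Integration.integral_combine[where a=0 and c=y and b=1 and f=K] that Ki[of 0 1] by (simp add: M_def)
      have cW: "continuous_on {0..1} W"
      proof -
        have mid: "M (2 * x) = M 1 - M (2 * x - 1)" if "x * 2 = 1" for x
        proof -
          have "2 * x = 1" using that by simp
          then show ?thesis by (simp add: M0)
        qed
        have "continuous_on ({0..1/2} \<union> {1/2..1}) (\<lambda>x. if x \<le> 1/2 then M (2 * x) else M 1 - M (2 * x - 1))"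
          by (rule continuous_on_cases)
             (auto simp: mid intro!: continuous_on_compose2[OF cM] continuous_intros)
        moreover have "{0..1/2} \<union> {1/2..1} = {0..1::real}" by auto
        ultimately show ?thesis unfolding W_def by simp
      qed
      have ck': "card (kappa k) = Suc n" using od by (simp add: ck e_def)
      show ?thesis
      proof (intro exI[of _ F] conjI ballI allI impI)
        show "continuous_on {0..1} F" unfolding F_def by (intro continuous_intros cW)
        show "F 0 = F 1" by (simp add: F_def W_def M0)
        fix x :: real assume x: "x \<in> {0..1}"
        have "\<bar>W x\<bar> \<le> (1/2) ^ \<Sum>(kappa k')"
          using Kb[of 0 "2*x"] Kb[of "2*x-1" 1] M1[of "2*x-1"] x by (auto simp: W_def M_def)
        then show "\<bar>F x\<bar> \<le> (1/2) ^ \<Sum>(kappa k)"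
          using od by (simp add: F_def sk e_def power_add abs_mult mult.commute)
      next
        fix g :: "nat \<Rightarrow> real \<Rightarrow> real"
        assume "\<forall>i<card (kappa k). \<forall>x\<in>{0..1}. (g i has_real_derivative g (Suc i) x) (at x within {0..1})"
          and "continuous_on {0..1} (g (card (kappa k)))"
        then have g: "\<And>i x. i < Suc n \<Longrightarrow> x \<in> {0..1} \<Longrightarrow> (g i has_real_derivative g (Suc i) x) (at x within {0..1})"
          and gc: "continuous_on {0..1} (g (Suc n))" by (auto simp: ck')
        have gcn: "continuous_on {0..1} (g n)"
          using g[of n] by (meson DERIV_continuous continuous_on_eq_continuous_within lessI)
        define G G' where "G = g n" and "G' = g (Suc n)"
        have cG': "continuous_on {0..1} (\<lambda>y. G' (y/2 + t))"
          and cG: "continuous_on {0..1} (\<lambda>y. G (y/2 + t))" if "t = 0 \<or> t = 1/2" for t :: real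
          unfolding G_def G'_def
          by (rule continuous_on_compose2[OF gc] continuous_on_compose2[OF gcn];
              use that in \<open>auto intro!: continuous_intros\<close>)+
        have dG: "((\<lambda>y. G (y/2 + t)) has_real_derivative G' (y/2+t) / 2) (at y within {0..1})"
          if t: "t = 0 \<or> t = 1/2" and y: "y \<in> {0..1}" for t y :: real
        proof -
          have sub: "(\<lambda>y. y/2 + t) ` {0..1} \<subseteq> {0..1}" using t by auto
          have "(g n has_real_derivative g (Suc n) (y/2+t)) (at (y/2+t) within (\<lambda>y. y/2 + t) ` {0..1})"
            by (rule has_field_derivative_subset[OF g[OF lessI] sub]) (use t y in auto)
          then have "((g n \<circ> (\<lambda>y. y/2+t)) has_real_derivative g (Suc n) (y/2+t) * (1/2)) (at y within {0..1})"
            by (rule DERIV_image_chain) (auto intro!: derivative_eq_intros)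
          then show ?thesis by (simp add: o_def G_def G'_def)
        qed
        define H where "H y = G (y/2) - G (y/2 + 1/2)" for y
        have I1: "((\<lambda>y. (G' (y/2) - G' (y/2+1/2)) / 2 * M y + H y * K y) has_integral H 1 * M 1 - H 0 * M 0) {0..1}"
        proof (rule fundamental_theorem_of_calculus)
          fix y :: real assume y: "y \<in> {0..1}"
          have "((\<lambda>y. H y * M y) has_real_derivative (G' (y/2) - G' (y/2+1/2)) / 2 * M y + H y * K y) (at y within {0..1})"
            unfolding H_def using dG[of 0 y] dG[of "1/2" y] dM[OF y] y
            by (auto intro!: derivative_eq_intros simp: field_simps)
          then show "((\<lambda>y. H y * M y) has_vector_derivative (G' (y/2) - G' (y/2+1/2)) / 2 * M y + H y * K y) (at y within {0..1})"
            by (simp add: has_real_derivative_iff_has_vector_derivative)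
        qed simp
        \<comment> \<open>Multiplied by \<open>M 1\<close>, this cancels the boundary term
          \<open>H 1 * M 1\<close> of \<open>I1\<close>, because \<open>H 1 = G (1/2) - G 1\<close>;
          the other one vanishes by \<open>M 0 = 0\<close>.\<close>
        have I2: "((\<lambda>y. G' (y/2+1/2) / 2) has_integral G 1 - G (1/2)) {0..1}"
          using fundamental_theorem_of_calculus[of 0 1 "\<lambda>y. G (y/2+1/2)" "\<lambda>y. G' (y/2+1/2) / 2"]
            dG[of "1/2"] by (simp add: has_real_derivative_iff_has_vector_derivative)
        define P Q where "P = integral {0..1} (\<lambda>y. G' (y/2) * M y)"
          and "Q = integral {0..1} (\<lambda>y. G' (y/2+1/2) * (M 1 - M y))"
        have iP: "((\<lambda>y. G' (y/2) * M y) has_integral P) {0..1}" unfolding P_def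
          using cG'[of 0] by (intro integrable_integral integrable_continuous_interval continuous_intros cM) simp
        have iQ: "((\<lambda>y. G' (y/2+1/2) * (M 1 - M y)) has_integral Q) {0..1}" unfolding Q_def
          using cG'[of "1/2"] by (intro integrable_integral integrable_continuous_interval continuous_intros cM) simp
        have HK: "((\<lambda>y. H y * K y) has_integral - (P + Q) / 2) {0..1}"
        proof -
          have "((\<lambda>y. ((G' (y/2) - G' (y/2+1/2)) / 2 * M y + H y * K y) + M 1 * (G' (y/2+1/2) / 2)
              - (G' (y/2) * M y) * (1/2) - (G' (y/2+1/2) * (M 1 - M y)) * (1/2)) has_integral
              (H 1 * M 1 - H 0 * M 0) + M 1 * (G 1 - G (1/2)) - P * (1/2) - Q * (1/2)) {0..1}"
            by (intro has_integral_diff has_integral_add I1 has_integral_mult_right[OF I2]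
                has_integral_mult_left[OF iP] has_integral_mult_left[OF iQ])
          moreover have "(H 1 * M 1 - H 0 * M 0) + M 1 * (G 1 - G (1/2)) - P * (1/2) - Q * (1/2) = - (P + Q) / 2"
            by (simp add: M0 H_def field_simps)
          moreover have "((G' (y/2) - G' (y/2+1/2)) / 2 * M y + H y * K y) + M 1 * (G' (y/2+1/2) / 2)
              - (G' (y/2) * M y) * (1/2) - (G' (y/2+1/2) * (M 1 - M y)) * (1/2) = H y * K y" for y
            by (simp add: field_simps)
          ultimately show ?thesis by (simp only:)
        qed
        have iW: "((\<lambda>x. G' x * W x) has_integral (P + Q) / 2) {0..1}"
          by (rule has_integral_glue_halves[OF iP iQ]) (auto simp: W_def diff_divide_distrib)
        have iF: "((\<lambda>x. G' x * F x) has_integral - ((1/2)^(Suc n)) * ((P + Q) / 2)) {0..1}"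
          using has_integral_mult_right[OF iW, of "- ((1/2)^(Suc n))"] unfolding F_def by (simp add: mult_ac)
        have h: "((\<lambda>x. g 0 x * wal1 k x) has_integral
          (integral {0..1} (\<lambda>y. (1/2)^n * G (y/2) * K y) -
           integral {0..1} (\<lambda>y. (1/2)^n * G (y/2 + 1/2) * K y)) / 2) {0..1}"
          using halves[of g] g gcn od by (simp add: G_def)
        have "integral {0..1} (\<lambda>y. (1/2)^n * G (y/2) * K y) - integral {0..1} (\<lambda>y. (1/2)^n * G (y/2 + 1/2) * K y)
           = integral {0..1} (\<lambda>y. (1/2)^n * (H y * K y))"
          unfolding H_def using cG[of 0] cG[of "1/2"]
          by (subst integral_diff[symmetric])
             (auto simp: algebra_simps intro!: integrable_continuous_interval continuous_intros K(1))
        also have "\<dots> = (1/2)^n * (- (P + Q) / 2)"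
          using has_integral_mult_right[OF HK, of "(1/2)^n"] by (rule integral_unique)
        finally have e: "integral {0..1} (\<lambda>y. (1/2)^n * G (y/2) * K y) -
            integral {0..1} (\<lambda>y. (1/2)^n * G (y/2 + 1/2) * K y) = (1/2)^n * (- (P + Q) / 2)" .
        have "(integral {0..1} (\<lambda>y. (1/2)^n * G (y/2) * K y) -
            integral {0..1} (\<lambda>y. (1/2)^n * G (y/2 + 1/2) * K y)) / 2 = integral {0..1} (\<lambda>x. G' x * F x)"
          unfolding e integral_unique[OF iF] by (simp add: field_simps)
        then show "((\<lambda>x. g 0 x * wal1 k x) has_integral
           integral {0..1} (\<lambda>x. g (card (kappa k)) x * F x)) {0..1}"
          using h unfolding ck' G'_def by (simp only:)
      qed
    qed
  qed
qed

section \<open>Topology, measure and partial derivatives on the cube\<close>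

abbreviation unitM :: "real measure" where
  "unitM \<equiv> restrict_space lborel {0..1}"

lemma prob_space_unitM: "prob_space unitM"
  by (rule prob_spaceI) (simp add: emeasure_restrict_space space_restrict_space)

lemma prob_space_cubeM: "prob_space (cubeM s)"
  unfolding cubeM_def by (rule prob_space_PiM) (rule prob_space_unitM)

lemma space_cubeM: "space (cubeM s) = cube s"
  by (simp add: cubeM_def cube_def space_PiM space_restrict_space)

text \<open>Since points are extensional, the cube is a product over all natural numbers with
  singleton factors beyond the dimension, and Tychonoff's theorem applies.\<close>

lemma compact_cube: "compact (cube s)"
proof -
  have e: "cube s = PiE UNIV (\<lambda>i. if i < s then {0..1} else {undefined})"
    by (fastforce simp: cube_def PiE_def Pi_def extensional_def split: if_splits)
  have "compactin (product_topology (\<lambda>_::nat. euclidean :: real topology) UNIV) (cube s)"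
    unfolding e by (subst compactin_PiE) auto
  then show ?thesis by (simp add: euclidean_product_topology)
qed

text \<open>With countably many coordinates, measurability into the Borel sets of the function space
  can be tested coordinatewise; coordinates beyond the dimension are constantly
  \<open>undefined\<close>.\<close>

lemma borel_measurable_cubeM:
  fixes h :: "(nat \<Rightarrow> real) \<Rightarrow> real"
  assumes "continuous_on (cube s) h"
  shows "h \<in> borel_measurable (cubeM s)"
proof -
  have "(\<lambda>x i. x i) \<in> measurable (cubeM s) borel"
  proof (rule measurable_coordinatewise_then_product)
    fix i
    show "(\<lambda>x. x i) \<in> borel_measurable (cubeM s)"
    proof (cases "i < s")
      case True
      have "(\<lambda>x. x i) \<in> measurable (cubeM s) unitM"
        unfolding cubeM_def by (rule measurable_component_singleton) (use True in simp)
      then show ?thesis by (rule measurable_compose) (auto intro!: measurable_restrict_space1)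
    next
      case False
      then have "x i = undefined" if "x \<in> space (cubeM s)" for x
        using that by (auto simp: space_cubeM cube_def PiE_def extensional_def)
      then have "(\<lambda>x. x i) \<in> borel_measurable (cubeM s) \<longleftrightarrow> (\<lambda>_. undefined :: real) \<in> borel_measurable (cubeM s)"
        by (rule measurable_cong)
      then show ?thesis by simp
    qed
  qed
  then have "(\<lambda>x. x) \<in> measurable (cubeM s) (restrict_space borel (cube s))"
    by (intro measurable_restrict_space2) (auto simp: space_cubeM)
  then show ?thesis
    using borel_measurable_continuous_on_restrict[OF assms] by (rule measurable_compose)
qed

lemma bounded_on_cube:
  fixes h :: "(nat \<Rightarrow> real) \<Rightarrow> real"
  assumes "continuous_on (cube s) h"
  obtains b where "\<And>x. x \<in> cube s \<Longrightarrow> \<bar>h x\<bar> \<le> b"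
  using compact_imp_bounded[OF compact_continuous_image[OF assms compact_cube]]
  by (auto simp: bounded_iff)

lemma smooth_cube_continuous: "smooth_cube s h \<Longrightarrow> continuous_on (cube s) h"
  unfolding smooth_cube_def by (drule spec[of _ "[]"]) (simp add: iter_partial_def)

lemma smooth_cube_partial:
  assumes "smooth_cube s h" "j < s"
  shows "smooth_cube s (partial j h)"
  unfolding smooth_cube_def
proof (intro allI impI)
  fix js assume "set js \<subseteq> {..<s}"
  then have "set (js @ [j]) \<subseteq> {..<s}" using assms(2) by simp
  moreover have "iter_partial js (partial j h) = iter_partial (js @ [j]) h"
    by (simp add: iter_partial_def)
  ultimately show "continuous_on (cube s) (iter_partial js (partial j h)) \<and>
       (\<forall>x\<in>cube s. \<forall>ja<s. \<exists>D. ((\<lambda>t. iter_partial js (partial j h) (x(ja := t))) has_real_derivative D)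
                               (at (x ja) within {0..1}))"
    using assms(1) unfolding smooth_cube_def by metis
qed

lemma smooth_cube_funpow_partial:
  "smooth_cube s h \<Longrightarrow> j < s \<Longrightarrow> smooth_cube s ((partial j ^^ n) h)"
  by (induction n) (auto intro: smooth_cube_partial)

lemma smooth_cube_mixed_from:
  "smooth_cube s f \<Longrightarrow> set js \<subseteq> {..<s} \<Longrightarrow> smooth_cube s (foldr (\<lambda>j h. (partial j ^^ a j) h) js f)"
  by (induction js) (auto intro: smooth_cube_funpow_partial)

lemma cube_upd: "x \<in> cube s \<Longrightarrow> j < s \<Longrightarrow> t \<in> {0..1} \<Longrightarrow> x(j := t) \<in> cube s"
  by (auto simp: cube_def PiE_def Pi_def extensional_def)

text \<open>\<open>partial\<close> is a choice of derivative, so smoothness must supply existence.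
  Applying it at the moved base point \<open>x(j := t)\<close> gives the derivative at every
  \<open>t\<close> of the line through \<open>x\<close>, as the one-dimensional kernel
  needs.\<close>

lemma smooth_cube_has_partial:
  assumes h: "smooth_cube s h" and x: "x \<in> cube s" and j: "j < s" and t: "t \<in> {0..1}"
  shows "((\<lambda>u. h (x(j := u))) has_real_derivative partial j h (x(j := t))) (at t within {0..1})"
proof -
  have "\<exists>D. ((\<lambda>u. h ((x(j := t))(j := u))) has_real_derivative D) (at ((x(j := t)) j) within {0..1})"
  proof -
    have "\<forall>x\<in>cube s. \<forall>j<s. \<exists>D. ((\<lambda>t. h (x(j := t))) has_real_derivative D) (at (x j) within {0..1})"
      using h unfolding smooth_cube_def by (auto dest!: spec[of _ "[]"] simp: iter_partial_def)
    from this[rule_format, OF cube_upd[OF x j t] j] show ?thesis .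
  qed
  then have "((\<lambda>u. h ((x(j := t))(j := u))) has_real_derivative partial j h (x(j := t))) (at ((x(j := t)) j) within {0..1})"
    unfolding partial_def by (rule someI_ex)
  then show ?thesis by simp
qed

section \<open>Exchanging Walsh functions for kernels, one coordinate at a time\<close>

lemma wal1_measurable [measurable]: "wal1 k \<in> borel_measurable borel"
proof -
  have "wal1 k = (\<lambda>x. \<Prod>l\<in>kappa k. (-1) ^ (nat \<lfloor>2 ^ l * x\<rfloor> mod 2))"
    by (simp add: wal1_def xdig_def power_sum fun_eq_iff)
  also have "\<dots> \<in> borel_measurable borel" by measurable
  finally show ?thesis .
qed

lemma abs_wal1 [simp]: "\<bar>wal1 k x\<bar> = 1"
  by (simp add: wal1_def power_abs)

lemma walsh_eq_prod: "walsh s k x = (\<Prod>j<s. wal1 (k j) (x j))"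
  by (simp add: walsh_def wal1_def power_sum)

text \<open>Bridge between the Lebesgue integral defining \<open>fhat\<close> and the gauge integral
  in which the kernel identity is proved.\<close>

lemma integral_unitM_eq:
  fixes f :: "real \<Rightarrow> real"
  assumes f: "f \<in> borel_measurable unitM" and b: "\<And>x. x \<in> {0..1} \<Longrightarrow> \<bar>f x\<bar> \<le> b"
  shows "integral\<^sup>L unitM f = integral {0..1} f"
proof -
  interpret prob_space unitM by (rule prob_space_unitM)
  have "integrable unitM f"
    by (rule integrable_const_bound[of _ b]) (use f b in \<open>auto simp: space_restrict_space\<close>)
  then have "set_integrable lborel {0..1} f"
    by (simp add: integrable_restrict_space set_integrable_def)
  then have "(LINT x:{0..1}|lborel. f x) = integral {0..1} f"
    by (rule set_borel_integral_eq_integral)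
  then show ?thesis by (simp add: integral_restrict_space set_lebesgue_integral_def)
qed

lemma measurable_prod_component:
  assumes "\<And>i. i < s \<Longrightarrow> U i \<in> borel_measurable unitM"
  shows "(\<lambda>x. \<Prod>i<s. U i (x i) :: real) \<in> borel_measurable (cubeM s)"
proof (rule borel_measurable_prod)
  fix i assume "i \<in> {..<s}"
  then have "(\<lambda>x. x i) \<in> measurable (cubeM s) unitM"
    unfolding cubeM_def by (rule measurable_component_singleton)
  then show "(\<lambda>x. U i (x i)) \<in> borel_measurable (cubeM s)"
    by (rule measurable_compose) (use assms \<open>i \<in> {..<s}\<close> in simp)
qed

lemma integrable_cube_prod:
  fixes h :: "(nat \<Rightarrow> real) \<Rightarrow> real"
  assumes h: "continuous_on (cube s) h"
    and U: "\<And>i. i < s \<Longrightarrow> U i \<in> borel_measurable unitM"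
    and U1: "\<And>i t. i < s \<Longrightarrow> t \<in> {0..1} \<Longrightarrow> \<bar>U i t\<bar> \<le> 1"
  shows "integrable (cubeM s) (\<lambda>x. h x * (\<Prod>i<s. U i (x i)))"
proof -
  interpret prob_space "cubeM s" by (rule prob_space_cubeM)
  obtain b where b: "\<And>x. x \<in> cube s \<Longrightarrow> \<bar>h x\<bar> \<le> b" using bounded_on_cube[OF h] by blast
  have "\<bar>h x * (\<Prod>i<s. U i (x i))\<bar> \<le> b" if x: "x \<in> cube s" for x
  proof -
    have "\<bar>\<Prod>i<s. U i (x i)\<bar> \<le> 1" unfolding abs_prod
      by (rule prod_le_1) (use x U1 in \<open>auto simp: cube_def PiE_def Pi_def\<close>)
    then have "\<bar>h x\<bar> * \<bar>\<Prod>i<s. U i (x i)\<bar> \<le> b * 1" using b[OF x] by (intro mult_mono) auto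
    then show ?thesis by (simp add: abs_mult)
  qed
  then show ?thesis
    by (intro integrable_const_bound[of _ b] borel_measurable_times borel_measurable_cubeM h
        measurable_prod_component U) (auto simp: space_cubeM)
qed

lemma continuous_on_unit_measurable:
  "continuous_on {0..1} g \<Longrightarrow> (g :: real \<Rightarrow> real) \<in> borel_measurable unitM"
  using borel_measurable_continuous_on_restrict[of "{0..1}" g]
  by (simp cong: measurable_cong_sets add: sets_restrict_space)

lemma continuous_on_slice:
  assumes h: "continuous_on (cube s) (h :: (nat \<Rightarrow> real) \<Rightarrow> real)" and x: "x \<in> cube s" and j: "j < s"
  shows "continuous_on {0..1} (\<lambda>t. h (x(j := t)))"
proof (rule continuous_on_compose2[OF h])
  show "continuous_on {0..1} (\<lambda>t. x(j := t))"
  proof (rule continuous_on_coordinatewise_then_product)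
    show "continuous_on {0..1} (\<lambda>t. (x(j := t)) i)" for i
      by (cases "i = j") auto
  qed
qed (use x j cube_upd in blast)

text \<open>Fubini isolates coordinate \<open>j\<close>; the factors of the other coordinates are
  constant along a slice, on which the one-dimensional kernel identity replaces
  \<open>wal1 k\<close> by \<open>K\<close> at the price of \<open>card (kappa k)\<close>
  derivatives.\<close>

lemma integral_cube_kernel_step:
  assumes h: "smooth_cube s h" and j: "j < s"
    and U: "\<And>i. i < s \<Longrightarrow> U i \<in> borel_measurable unitM"
    and U1: "\<And>i t. i < s \<Longrightarrow> t \<in> {0..1} \<Longrightarrow> \<bar>U i t\<bar> \<le> 1"
    and Uj: "U j = wal1 k"
    and K: "continuous_on {0..1} K" and K1: "\<And>t. t \<in> {0..1} \<Longrightarrow> \<bar>K t\<bar> \<le> 1"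
    and Kg: "\<And>g :: nat \<Rightarrow> real \<Rightarrow> real.
        (\<forall>i<card (kappa k). \<forall>x\<in>{0..1}. (g i has_real_derivative g (Suc i) x) (at x within {0..1})) \<Longrightarrow>
        continuous_on {0..1} (g (card (kappa k))) \<Longrightarrow>
        ((\<lambda>x. g 0 x * wal1 k x) has_integral
           integral {0..1} (\<lambda>x. g (card (kappa k)) x * K x)) {0..1}"
  shows "(LINT x|cubeM s. h x * (\<Prod>i<s. U i (x i))) =
    (LINT x|cubeM s. (partial j ^^ card (kappa k)) h x * (\<Prod>i<s. (U(j := K)) i (x i)))"
proof -
  let ?n = "card (kappa k)" and ?I = "{..<s} - {j}"
  interpret product_sigma_finite "\<lambda>_::nat. unitM"
    by (simp add: product_sigma_finite_def prob_space_imp_sigma_finite prob_space_unitM)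
  have I: "insert j ?I = {..<s}" using j by auto
  define g where "g i = (partial j ^^ i) h" for i
  have sg: "smooth_cube s (g i)" for i unfolding g_def by (rule smooth_cube_funpow_partial[OF h j])
  have cg: "continuous_on (cube s) (g i)" for i by (rule smooth_cube_continuous[OF sg])
  have KU: "i < s \<Longrightarrow> (U(j := K)) i \<in> borel_measurable unitM"
    "i < s \<Longrightarrow> t \<in> {0..1} \<Longrightarrow> \<bar>(U(j := K)) i t\<bar> \<le> 1" for i t
    using U U1 K K1 by (auto intro: continuous_on_unit_measurable)
  have split: "(LINT x|cubeM s. g i x * (\<Prod>i<s. V i (x i))) =
      (LINT x|PiM ?I (\<lambda>_. unitM). (LINT t|unitM. g i (x(j := t)) * V j t) * (\<Prod>i\<in>?I. V i (x i)))"
    if V: "\<And>i. i < s \<Longrightarrow> V i \<in> borel_measurable unitM"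
      "\<And>i t. i < s \<Longrightarrow> t \<in> {0..1} \<Longrightarrow> \<bar>V i t\<bar> \<le> 1" for i V
  proof -
    have "(LINT x|cubeM s. g i x * (\<Prod>i<s. V i (x i))) =
      (LINT x|PiM ?I (\<lambda>_. unitM). (LINT t|unitM. g i (x(j := t)) * (\<Prod>i<s. V i ((x(j := t)) i))))"
      using product_integral_insert[of ?I j "\<lambda>x. g i x * (\<Prod>i<s. V i (x i))", unfolded I]
        integrable_cube_prod[OF cg V, of "\<lambda>i. i" i] by (simp add: cubeM_def)
    also have "\<dots> = (LINT x|PiM ?I (\<lambda>_. unitM). (LINT t|unitM. (g i (x(j := t)) * V j t) * (\<Prod>i\<in>?I. V i (x i))))"
    proof (intro Bochner_Integration.integral_cong refl)
      fix x t
      have "(\<Prod>i<s. V i ((x(j := t)) i)) = V j t * (\<Prod>i\<in>?I. V i ((x(j := t)) i))"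
        using j by (subst prod.remove[of _ j]) auto
      also have "(\<Prod>i\<in>?I. V i ((x(j := t)) i)) = (\<Prod>i\<in>?I. V i (x i))"
        by (rule prod.cong) auto
      finally show "g i (x(j := t)) * (\<Prod>i<s. V i ((x(j := t)) i)) = (g i (x(j := t)) * V j t) * (\<Prod>i\<in>?I. V i (x i))"
        by (simp add: mult_ac)
    qed
    finally show ?thesis by simp
  qed
  have slice: "(LINT t|unitM. g 0 (x(j := t)) * wal1 k t) = (LINT t|unitM. g ?n (x(j := t)) * K t)"
    if x: "x \<in> space (PiM ?I (\<lambda>_. unitM))" for x
  proof -
    \<comment> \<open>A point of the smaller product is \<open>undefined\<close> at
      \<open>j\<close>. The filler 0 only places it in the cube and is overwritten by
      \<open>t\<close> afterwards.\<close>
    have xu: "x(j := 0) \<in> cube s"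
      using x j by (auto simp: space_PiM space_restrict_space cube_def PiE_def Pi_def extensional_def)
    have cs: "continuous_on {0..1} (\<lambda>t. g i (x(j := t)))" for i
      using continuous_on_slice[OF cg xu j, of i] by simp
    have "\<exists>b. \<forall>t\<in>{0..1}. \<bar>g i (x(j := t))\<bar> \<le> b" for i
      using compact_imp_bounded[OF compact_continuous_image[OF cs[of i] compact_Icc]]
      by (simp add: bounded_iff)
    then obtain b where b: "\<And>i t. t \<in> {0..1} \<Longrightarrow> \<bar>g i (x(j := t))\<bar> \<le> b i"
      by metis
    have ii: "(LINT t|unitM. g i (x(j := t)) * w t) = integral {0..1} (\<lambda>t. g i (x(j := t)) * w t)"
      if w: "w \<in> borel_measurable unitM" "\<And>t. t \<in> {0..1} \<Longrightarrow> \<bar>w t\<bar> \<le> 1" for i w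
    proof (rule integral_unitM_eq)
      show "(\<lambda>t. g i (x(j := t)) * w t) \<in> borel_measurable unitM"
        by (intro borel_measurable_times w continuous_on_unit_measurable cs)
      show "\<bar>g i (x(j := t)) * w t\<bar> \<le> b i" if "t \<in> {0..1}" for t
        using mult_mono[OF b[OF that, of i] w(2)[OF that]] b[OF that, of i] by (simp add: abs_mult)
    qed
    have "((\<lambda>t. g 0 (x(j := t)) * wal1 k t) has_integral
        integral {0..1} (\<lambda>t. g ?n (x(j := t)) * K t)) {0..1}"
    proof (rule Kg[of "\<lambda>i t. g i (x(j := t))"])
      show "\<forall>i<?n. \<forall>t\<in>{0..1}. ((\<lambda>t. g i (x(j := t))) has_real_derivative g (Suc i) (x(j := t))) (at t within {0..1})"
        using smooth_cube_has_partial[OF sg xu j] by (simp add: g_def)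
    qed (rule cs)
    then have "integral {0..1} (\<lambda>t. g 0 (x(j := t)) * wal1 k t) = integral {0..1} (\<lambda>t. g ?n (x(j := t)) * K t)"
      by (rule integral_unique)
    moreover have "(LINT t|unitM. g 0 (x(j := t)) * wal1 k t) = integral {0..1} (\<lambda>t. g 0 (x(j := t)) * wal1 k t)"
      by (rule ii) (use U[OF j] Uj in auto)
    moreover have "(LINT t|unitM. g ?n (x(j := t)) * K t) = integral {0..1} (\<lambda>t. g ?n (x(j := t)) * K t)"
      by (rule ii[OF continuous_on_unit_measurable[OF K] K1])
    ultimately show ?thesis by simp
  qed
  have "(LINT x|cubeM s. g 0 x * (\<Prod>i<s. U i (x i))) =
      (LINT x|PiM ?I (\<lambda>_. unitM). (LINT t|unitM. g 0 (x(j := t)) * wal1 k t) * (\<Prod>i\<in>?I. U i (x i)))"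
    using split[of U 0, OF U U1] by (simp add: Uj)
  also have "\<dots> = (LINT x|PiM ?I (\<lambda>_. unitM). (LINT t|unitM. g ?n (x(j := t)) * K t) * (\<Prod>i\<in>?I. (U(j := K)) i (x i)))"
    by (intro Bochner_Integration.integral_cong refl arg_cong2[where f="(*)"] slice prod.cong) auto
  also have "\<dots> = (LINT x|cubeM s. g ?n x * (\<Prod>i<s. (U(j := K)) i (x i)))"
    using split[of "U(j := K)" ?n, OF KU] by simp
  finally show ?thesis by (simp add: g_def)
qed

text \<open>After all coordinates are exchanged, the Walsh function has become a product of kernels
  bounded by \<open>(1/2) ^ norm1 s k\<close>, and only the L1 norm of the mixed derivative
  remains.\<close>

lemma abs_fhat_le:
  assumes f: "smooth_cube s f"
    and C: "(\<integral>\<^sup>+ x. ennreal \<bar>mixed s (\<lambda>j. card (kappa (k j))) f x\<bar> \<partial>cubeM s) \<le> ennreal C" "0 \<le> C"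
  shows "\<bar>fhat s f k\<bar> \<le> (1/2) ^ norm1 s k * C"
proof -
  obtain K where K: "\<And>j. continuous_on {0..1} (K j)"
    "\<And>j x. x \<in> {0..1} \<Longrightarrow> \<bar>K j x\<bar> \<le> (1/2) ^ \<Sum>(kappa (k j))"
    "\<And>j (g :: nat \<Rightarrow> real \<Rightarrow> real).
        (\<forall>i<card (kappa (k j)). \<forall>x\<in>{0..1}. (g i has_real_derivative g (Suc i) x) (at x within {0..1})) \<Longrightarrow>
        continuous_on {0..1} (g (card (kappa (k j)))) \<Longrightarrow>
        ((\<lambda>x. g 0 x * wal1 (k j) x) has_integral
           integral {0..1} (\<lambda>x. g (card (kappa (k j))) x * K j x)) {0..1}"
  proof -
    have "\<forall>j. \<exists>K. continuous_on {0..1} K \<and> (\<forall>x\<in>{0..1}. \<bar>K x\<bar> \<le> (1/2) ^ \<Sum>(kappa (k j))) \<and>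
     (\<forall>g :: nat \<Rightarrow> real \<Rightarrow> real.
        (\<forall>i<card (kappa (k j)). \<forall>x\<in>{0..1}. (g i has_real_derivative g (Suc i) x) (at x within {0..1})) \<longrightarrow>
        continuous_on {0..1} (g (card (kappa (k j)))) \<longrightarrow>
        ((\<lambda>x. g 0 x * wal1 (k j) x) has_integral
           integral {0..1} (\<lambda>x. g (card (kappa (k j))) x * K x)) {0..1})"
      using walsh_kernel_exists by blast
    from choice[OF this] show ?thesis using that by blast
  qed
  have K1: "\<bar>K j t\<bar> \<le> 1" if "t \<in> {0..1}" for j t
    using K(2)[OF that, of j] power_le_one[of "1/2::real" "\<Sum>(kappa (k j))"] by simp
  define a where "a j = card (kappa (k j))" for j
  \<comment> \<open>At stage \<open>i\<close> the coordinates from \<open>i\<close> upwards carry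
    derivatives and kernels, those below still carry Walsh factors. Going from the last coordinate
    to the first matches the nesting of \<open>foldr\<close> in \<open>mixed\<close>.\<close>
  define F where "F i = foldr (\<lambda>j h. (partial j ^^ a j) h) [i..<s] f" for i
  define V where "V i j = (if j < i then wal1 (k j) else K j)" for i j
  have V: "V i j \<in> borel_measurable unitM" "t \<in> {0..1} \<Longrightarrow> \<bar>V i j t\<bar> \<le> 1" for i j t
  proof -
    have "wal1 (k j) \<in> borel_measurable lborel" by measurable
    then have "wal1 (k j) \<in> borel_measurable unitM" by (rule measurable_restrict_space1)
    with continuous_on_unit_measurable[OF K(1)[of j]] show "V i j \<in> borel_measurable unitM"
      unfolding V_def by presburger
    show "t \<in> {0..1} \<Longrightarrow> \<bar>V i j t\<bar> \<le> 1" using K1[of t j] by (simp add: V_def)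
  qed
  have sF: "smooth_cube s (F i)" for i unfolding F_def by (rule smooth_cube_mixed_from[OF f]) auto
  have step: "fhat s f k = (LINT x|cubeM s. F (s - n) x * (\<Prod>j<s. V (s - n) j (x j)))" if "n \<le> s" for n
    using that
  proof (induction n)
    case 0
    have "(\<Prod>j<s. V s j (x j)) = walsh s k x" for x
      unfolding walsh_eq_prod by (rule prod.cong) (auto simp: V_def)
    then show ?case by (simp add: fhat_def F_def)
  next
    case (Suc n)
    define i where "i = s - Suc n"
    have i: "i < s" "s - n = Suc i" using Suc.prems by (auto simp: i_def)
    have FS: "F i = (partial i ^^ a i) (F (Suc i))" using i by (simp add: F_def upt_conv_Cons)
    have VS: "V i = (V (Suc i))(i := K i)" by (auto simp: V_def fun_eq_iff)
    have "fhat s f k = (LINT x|cubeM s. F (Suc i) x * (\<Prod>j<s. V (Suc i) j (x j)))"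
      using Suc i by simp
    also have "\<dots> = (LINT x|cubeM s. F i x * (\<Prod>j<s. V i j (x j)))"
      unfolding FS VS a_def
      by (rule integral_cube_kernel_step[OF sF i(1) V _ K(1) K1 K(3)]) (auto simp: V_def)
    finally show ?case by (simp add: i_def)
  qed
  have m: "mixed s a f = F 0" by (simp add: mixed_def F_def)
  have e: "fhat s f k = (LINT x|cubeM s. F 0 x * (\<Prod>j<s. K j (x j)))"
    using step[of s] by (simp add: V_def)
  have cF: "F 0 \<in> borel_measurable (cubeM s)" "integrable (cubeM s) (F 0)"
    using integrable_cube_prod[OF smooth_cube_continuous[OF sF], of "\<lambda>_ _. 1"]
      borel_measurable_cubeM[OF smooth_cube_continuous[OF sF]] by auto
  have "\<bar>fhat s f k\<bar> \<le> (LINT x|cubeM s. (1/2) ^ norm1 s k * \<bar>F 0 x\<bar>)"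
    unfolding e
  proof (rule integral_abs_bound[THEN order_trans], rule integral_mono)
    show "integrable (cubeM s) (\<lambda>x. \<bar>F 0 x * (\<Prod>j<s. K j (x j))\<bar>)"
      by (rule integrable_abs, rule integrable_cube_prod[OF smooth_cube_continuous[OF sF]])
         (auto intro!: continuous_on_unit_measurable K(1) K1)
    show "integrable (cubeM s) (\<lambda>x. (1/2) ^ norm1 s k * \<bar>F 0 x\<bar>)"
      using cF(2) by simp
    fix x assume "x \<in> space (cubeM s)"
    then have "x j \<in> {0..1}" if "j < s" for j using that by (auto simp: space_cubeM cube_def PiE_def Pi_def)
    then have "\<bar>\<Prod>j<s. K j (x j)\<bar> \<le> (\<Prod>j<s. (1/2) ^ \<Sum>(kappa (k j)))"
      unfolding abs_prod by (intro prod_mono) (auto intro!: K(2))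
    also have "\<dots> = (1/2) ^ norm1 s k" by (simp add: norm1_def power_sum)
    finally show "\<bar>F 0 x * (\<Prod>j<s. K j (x j))\<bar> \<le> (1/2) ^ norm1 s k * \<bar>F 0 x\<bar>"
      by (simp add: abs_mult mult.commute mult_left_mono)
  qed
  also have "\<dots> = (1/2) ^ norm1 s k * (LINT x|cubeM s. \<bar>F 0 x\<bar>)" by simp
  also have "(LINT x|cubeM s. \<bar>F 0 x\<bar>) \<le> C"
  proof -
    have "ennreal (LINT x|cubeM s. \<bar>F 0 x\<bar>) = (\<integral>\<^sup>+ x. ennreal \<bar>F 0 x\<bar> \<partial>cubeM s)"
      by (rule nn_integral_eq_integral[symmetric]) (use cF in auto)
    also have "\<dots> \<le> ennreal C" using C(1) m by (simp add: a_def[abs_def])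
    finally show ?thesis using C(2) by (simp add: ennreal_le_iff)
  qed
  finally show ?thesis by (simp add: mult_left_mono)
qed

section \<open>Counting by the norm of digit sets\<close>

text \<open>All digit positions of a vector gathered into one finite set, so that counting vectors
  becomes counting subsets of a grid.\<close>

definition dset :: "nat \<Rightarrow> (nat \<Rightarrow> nat) \<Rightarrow> (nat \<times> nat) set" where
  "dset s k = {(j, l). j < s \<and> l \<in> kappa (k j)}"

lemma dset_Sigma: "dset s k = Sigma {..<s} (\<lambda>j. kappa (k j))"
  by (auto simp: dset_def)

lemma finite_dset [simp]: "finite (dset s k)"
  by (simp add: dset_Sigma)

lemma norm1_dset: "norm1 s k = (\<Sum>p\<in>dset s k. snd p)"
  by (simp add: norm1_def dset_Sigma sum.Sigma case_prod_unfold)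

lemma kappa_inj: "kappa a = kappa b \<Longrightarrow> a = b"
proof (rule bit_eqI)
  fix n assume "kappa a = kappa b"
  then have "Suc n \<in> kappa a \<longleftrightarrow> Suc n \<in> kappa b" by simp
  then show "bit a n \<longleftrightarrow> bit b n" by (simp add: kappa_def)
qed

lemma inj_on_dset: "inj_on (dset s) (vecs s)"
proof (rule inj_onI)
  fix a b assume a: "a \<in> vecs s" and b: "b \<in> vecs s" and e: "dset s a = dset s b"
  show "a = b"
  proof
    fix j
    show "a j = b j"
    proof (cases "j < s")
      case True
      then have "kappa (a j) = kappa (b j)" using e by (auto simp: dset_def set_eq_iff)
      then show ?thesis by (rule kappa_inj)
    qed (use a b in \<open>auto simp: vecs_def\<close>)
  qed
qed

lemma dset_bound:
  assumes "norm1 s k \<le> N" shows "dset s k \<subseteq> {..<s} \<times> {1..N}"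
proof (clarsimp simp: dset_def)
  fix j l assume j: "j < s" and l: "l \<in> kappa (k j)"
  have "snd (j, l) \<le> (\<Sum>p\<in>dset s k. snd p)"
    by (rule member_le_sum) (use j l in \<open>auto simp: dset_def finite_dset[unfolded dset_def]\<close>)
  then show "Suc 0 \<le> l \<and> l \<le> N" using assms kappa_pos[OF l] by (simp add: norm1_dset)
qed

section \<open>Size of the balls \<open>QN\<close>\<close>

lemma finite_norm1_le: "finite {k \<in> vecs s. norm1 s k \<le> N}"
proof (rule finite_imageD)
  show "finite (dset s ` {k \<in> vecs s. norm1 s k \<le> N})"
    by (rule finite_subset[of _ "Pow ({..<s} \<times> {1..N})"]) (use dset_bound in auto)
  show "inj_on (dset s) {k \<in> vecs s. norm1 s k \<le> N}"
    by (rule inj_on_subset[OF inj_on_dset]) auto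
qed

lemma finite_QN [simp]: "finite (QN s N)"
  by (rule finite_subset[OF _ finite_norm1_le[of s N]]) (auto simp: QN_def)

lemma QN_mono: "N \<le> N' \<Longrightarrow> QN s N \<subseteq> QN s N'"
  by (auto simp: QN_def)

lemma zero_vecs [simp]: "(\<lambda>_. 0) \<in> vecs s"
  by (simp add: vecs_def)

lemma norm1_zero [simp]: "norm1 s (\<lambda>_. 0) = 0"
  by (simp add: norm1_def)

lemma insert_zero_QN: "insert (\<lambda>_. 0) (QN s N) = {k \<in> vecs s. norm1 s k \<le> N}"
  by (auto simp: QN_def)

lemma card_norm1_le: "card {k \<in> vecs s. norm1 s k \<le> N} = Suc (card (QN s N))"
  unfolding insert_zero_QN[symmetric] by (subst card_insert_disjoint) (simp, auto simp: QN_def)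

text \<open>Chernoff bound with weight \<open>exp (- t * norm1)\<close>, optimised at \<open>t = sqrt (s / N)\<close>.\<close>

lemma card_norm1_le_exp:
  "real (Suc (card (QN s N))) \<le> exp (2 * sqrt (real s * real N))"
proof (cases "s = 0 \<or> N = 0")
  case True
  then have "QN s N = {}"
  proof
    assume "s = 0" then show ?thesis by (auto simp: QN_def vecs_def)
  next
    assume N: "N = 0"
    have False if k: "k \<in> QN s N" for k
    proof -
      have "dset s k = dset s (\<lambda>_. 0)" using dset_bound[of s k 0] k N by (auto simp: QN_def dset_def)
      then have "k = (\<lambda>_. 0)" using inj_onD[OF inj_on_dset] k by (auto simp: QN_def)
      then show False using k by (simp add: QN_def)
    qed
    then show ?thesis by blast
  qed
  then show ?thesis by simp
next
  case False
  define t where "t = sqrt (real s / real N)"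
  define q where "q = exp (- t)"
  have t: "t > 0" using False by (simp add: t_def)
  have q: "0 < q" "q < 1" using t by (auto simp: q_def)
  let ?Q = "{k \<in> vecs s. norm1 s k \<le> N}" and ?S = "{..<s} \<times> {1..N}"
  have "real (card ?Q) * q ^ N = (\<Sum>k\<in>?Q. q ^ N)" by simp
  also have "\<dots> \<le> (\<Sum>k\<in>?Q. q ^ norm1 s k)"
    by (rule sum_mono) (use q in \<open>auto intro: power_decreasing\<close>)
  also have "\<dots> = (\<Sum>k\<in>?Q. \<Prod>p\<in>dset s k. q ^ snd p)"
    by (simp add: norm1_dset power_sum)
  also have "\<dots> = (\<Sum>A\<in>dset s ` ?Q. \<Prod>p\<in>A. q ^ snd p)"
    by (subst sum.reindex) (auto intro: inj_on_subset[OF inj_on_dset])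
  \<comment> \<open>Allowing every subset of the grid drops the norm constraint, and the sum factors
    into independent choices for the grid points.\<close>
  also have "\<dots> \<le> (\<Sum>A\<in>Pow ?S. \<Prod>p\<in>A. q ^ snd p)"
    by (rule sum_mono2) (use dset_bound q in \<open>auto intro!: prod_nonneg\<close>)
  also have "\<dots> = (\<Prod>p\<in>?S. q ^ snd p + 1)"
    by (subst prod_add) auto
  also have "\<dots> \<le> (\<Prod>p\<in>?S. exp (q ^ snd p))"
    by (rule prod_mono) (use q exp_ge_add_one_self in \<open>auto simp: add.commute intro!: add_nonneg_nonneg\<close>)
  also have "\<dots> = exp (\<Sum>p\<in>?S. q ^ snd p)" by (simp add: exp_sum)
  also have "(\<Sum>p\<in>?S. q ^ snd p) = real s * (\<Sum>l=1..N. q ^ l)"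
    by (simp add: sum.cartesian_product[symmetric, of "\<lambda>_ l. q ^ l", simplified case_prod_unfold])
  also have "exp \<dots> \<le> exp (real s * (1 / t))"
  proof -
    have "(\<Sum>l=1..N. q ^ l) = (q - q ^ Suc N) / (1 - q)"
      using sum_gp[of q 1 N] q False by simp
    also have "\<dots> \<le> q / (1 - q)" using q by (intro divide_right_mono) auto
    also have "\<dots> = 1 / (exp t - 1)" using q t by (simp add: q_def exp_minus field_simps)
    also have "\<dots> \<le> 1 / t" 
    proof (rule divide_left_mono)
      show "t \<le> exp t - 1" using exp_ge_add_one_self[of t] by linarith
      then show "0 < (exp t - 1) * t" using t by (intro mult_pos_pos) linarith+
    qed simp
    finally show ?thesis unfolding exp_le_cancel_iff by (rule mult_left_mono) simp
  qed
  finally have 1: "real (card ?Q) * q ^ N \<le> exp (real s / t)" by simp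
  have "q ^ N = exp (- (real N * t))" by (simp add: q_def exp_of_nat_mult[symmetric])
  then have "real (card ?Q) = (real (card ?Q) * q ^ N) * exp (real N * t)"
    by (simp add: exp_minus)
  also have "\<dots> \<le> exp (real s / t) * exp (real N * t)"
    using 1 by (rule mult_right_mono) simp
  also have "\<dots> = exp (real s / t + real N * t)" by (simp add: exp_add)
  also have "real s / t + real N * t = 2 * sqrt (real s * real N)"
    using False by (simp add: t_def real_sqrt_divide real_sqrt_mult field_simps)
  finally show ?thesis by (simp add: card_norm1_le)
qed

lemma kappa_less_power: "k < 2 ^ n \<Longrightarrow> kappa k \<subseteq> {1..n}"
proof (induction n arbitrary: k)
  case (Suc n)
  then have "kappa (k div 2) \<subseteq> {1..n}" by auto
  then show ?case by (subst kappa_div2) auto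
qed simp

text \<open>Vectors supported on the first coordinate with digits at positions 1 to \<open>n\<close>
  suffice: their norm is at most 1 + ... + n. The successor accounts for the zero vector, which
  \<open>QN\<close> excludes.\<close>

lemma card_QN_ge:
  assumes "1 \<le> s" "n * (n + 1) \<le> 2 * N"
  shows "2 ^ n \<le> Suc (card (QN s N))"
proof -
  define \<phi> where "\<phi> k = (\<lambda>j::nat. if j = 0 then k else 0 :: nat)" for k
  have "inj_on \<phi> {..<2 ^ n}" by (auto simp: \<phi>_def inj_on_def fun_eq_iff)
  moreover have "\<phi> k \<in> {k \<in> vecs s. norm1 s k \<le> N}" if "k < 2 ^ n" for k
  proof -
    have "norm1 s (\<phi> k) = (\<Sum>j<s. if j = 0 then \<Sum>(kappa k) else 0)"
      unfolding norm1_def by (rule sum.cong) (auto simp: \<phi>_def)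
    also have "\<dots> = \<Sum>(kappa k)" using assms(1) by (subst sum.delta) auto
    also have "\<dots> \<le> \<Sum>{1..n}" by (rule sum_mono2) (use kappa_less_power[OF that] in auto)
    also have "\<dots> = n * (n + 1) div 2" using gauss_sum_from_Suc_0[of n, where 'a=nat] by simp
    also have "\<dots> \<le> N" using assms(2) by linarith
    finally show ?thesis using assms(1) by (auto simp: \<phi>_def vecs_def)
  qed
  ultimately have "card {..<2 ^ n :: nat} \<le> card {k \<in> vecs s. norm1 s k \<le> N}"
    by (intro card_inj_on_le[of \<phi>] finite_norm1_le) auto
  then show ?thesis by (simp add: card_norm1_le)
qed

text \<open>The smallest sum of \<open>n\<close> distinct positive positions is n(n+1)/2.\<close>

lemma card_kappa_le_sum: "card (kappa k) * (card (kappa k) + 1) \<le> 2 * \<Sum>(kappa k)"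
proof (induction k rule: less_induct)
  case (less k)
  show ?case
  proof (cases "k = 0")
    case False
    then have "k div 2 < k" by simp
    from less.IH[OF this] show ?thesis
      by (simp add: card_kappa_div2[of k] sum_id_kappa_div2[of k] algebra_simps)
  qed simp
qed

lemma norm1_div2: "norm1 s (\<lambda>j. k j div 2) + norm0 s k = norm1 s k"
proof -
  have "\<Sum>(kappa (n div 2)) + card (kappa n) = \<Sum>(kappa n)" for n
    by (simp add: card_kappa_div2[of n] sum_id_kappa_div2[of n])
  then show ?thesis by (simp add: norm1_def norm0_def sum.distrib[symmetric])
qed

text \<open>Halving all coordinates lowers \<open>norm1\<close> by \<open>norm0\<close>, hence by at
  least \<open>h\<close>. It is injective once the set of odd coordinates is recorded, which costs
  the factor \<open>2 ^ s\<close>; the image may contain the zero vector.\<close>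

lemma card_QN_norm0_ge:
  "card {k \<in> QN s (N + h). h \<le> norm0 s k} \<le> 2 ^ s * Suc (card (QN s N))"
proof -
  let ?G = "{k \<in> QN s (N + h). h \<le> norm0 s k}"
  define \<phi> where "\<phi> k = ((\<lambda>j. k j div 2), {j. j < s \<and> odd (k j)})" for k :: "nat \<Rightarrow> nat"
  have "inj_on \<phi> ?G"
  proof (rule inj_onI)
    fix a b assume a: "a \<in> ?G" and b: "b \<in> ?G" and e: "\<phi> a = \<phi> b"
    show "a = b"
    proof
      fix j
      have "a j div 2 = b j div 2" using e by (auto simp: \<phi>_def fun_eq_iff)
      moreover have "odd (a j) \<longleftrightarrow> odd (b j)"
        using e a b by (cases "j < s") (auto simp: \<phi>_def QN_def vecs_def set_eq_iff)
      ultimately show "a j = b j" by (metis even_two_times_div_two odd_two_times_div_two_succ)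
    qed
  qed
  moreover have "\<phi> ` ?G \<subseteq> {k \<in> vecs s. norm1 s k \<le> N} \<times> Pow {..<s}"
  proof (rule image_subsetI)
    fix k assume "k \<in> ?G"
    then have k: "k \<in> QN s (N + h)" "h \<le> norm0 s k" by auto
    have "norm1 s (\<lambda>j. k j div 2) \<le> N" using norm1_div2[of s k] k by (auto simp: QN_def)
    then show "\<phi> k \<in> {k \<in> vecs s. norm1 s k \<le> N} \<times> Pow {..<s}"
      using k by (auto simp: \<phi>_def QN_def vecs_def)
  qed
  ultimately have "card ?G \<le> card ({k \<in> vecs s. norm1 s k \<le> N} \<times> Pow {..<s})"
    by (intro card_inj_on_le[of \<phi>]) (auto simp: finite_norm1_le)
  then show ?thesis by (simp add: card_cartesian_product card_norm1_le card_Pow mult.commute)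
qed

text \<open>Concentration with tolerance 1/2 shows that at least half of the larger ball has
  \<open>3/2 * ?T\<close> or more digits in coordinate 0, so \<open>norm0\<close> is at least
  \<open>h\<close> there and the halving map bounds that half. The two extra factors 2 come from the
  discarded half and from the zero vector.\<close>

lemma card_QN_shift:
  assumes s: "1 \<le> s" and AB: "AB'_hyp s A' B'"
  shows "\<exists>N0\<ge>1. \<forall>N\<ge>N0. \<forall>h. real h \<le> 3/2 * sqrt (lam * real N / real s) \<longrightarrow>
    card (QN s (N + h)) \<le> 2 ^ (s + 2) * card (QN s N)"
proof -
  have pos: "A' > 0" "B' > 0" using AB by (auto simp: AB'_hyp_def)
  have "eventually (\<lambda>N::nat. A' * real N powr (1/4) * exp (- B' * (1/2)^2 * sqrt (real N)) < 1/2) sequentially"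
    using pos by real_asymp
  then obtain N1 where N1: "\<And>N. N \<ge> N1 \<Longrightarrow> A' * real N powr (1/4) * exp (- B' * (1/2)^2 * sqrt (real N)) < 1/2"
    by (auto simp: eventually_sequentially)
  show ?thesis
  proof (intro exI[of _ "max 1 N1"] conjI allI impI)
    fix N h assume N: "max 1 N1 \<le> N" and h: "real h \<le> 3/2 * sqrt (lam * real N / real s)"
    let ?Q = "QN s (N + h)" and ?T = "sqrt (lam * real (N + h) / real s)"
    let ?B = "{k \<in> ?Q. \<bar>real (card (kappa (k 0))) / ?T - 2\<bar> > 1/2}"
    have lam: "lam > 0" by (simp add: lam_def)
    have T: "?T > 0" using lam s N by simp
    have Q1: "card (QN s N) \<ge> 1" using card_QN_ge[OF s, of 1 N] N by simp
    then have Q: "card ?Q > 0"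
      using card_mono[OF finite_QN QN_mono[of N "N + h" s]] by simp
    have "real (card ?B) / real (card ?Q) \<le> A' * real (N + h) powr (1/4) * exp (- B' * (1/2)^2 * sqrt (real (N + h)))"
    proof -
      have "\<forall>N::nat. \<forall>j<s. \<forall>\<epsilon>::real. 1 \<le> N \<longrightarrow> 0 < \<epsilon> \<longrightarrow> \<epsilon> < 1 \<longrightarrow>
        real (card {k \<in> QN s N. \<bar>real (card (kappa (k j))) / sqrt (lam * real N / real s) - 2\<bar> > \<epsilon>})
          / real (card (QN s N)) \<le> A' * real N powr (1/4) * exp (- B' * \<epsilon>^2 * sqrt (real N))"
        using AB unfolding AB'_hyp_def by blast
      from this[rule_format, of 0 "N + h" "1/2"] show ?thesis using s N by simp
    qed
    also have "\<dots> < 1/2" by (rule N1) (use N in simp)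
    finally have B: "2 * real (card ?B) \<le> real (card ?Q)" using Q by (simp add: field_simps)
    have "?Q - ?B \<subseteq> {k \<in> QN s (N + h). h \<le> norm0 s k}"
    proof (rule subsetI)
      fix k assume k: "k \<in> ?Q - ?B"
      then have "\<not> \<bar>real (card (kappa (k 0))) / ?T - 2\<bar> > 1/2" by blast
      then have "3/2 \<le> real (card (kappa (k 0))) / ?T" by linarith
      then have "3/2 * ?T \<le> real (card (kappa (k 0)))" using T by (simp add: field_simps)
      moreover have "sqrt (lam * real N / real s) \<le> ?T"
        using lam s by (simp add: divide_right_mono)
      ultimately have "real h \<le> real (card (kappa (k 0)))" using h by linarith
      moreover have "card (kappa (k 0)) \<le> norm0 s k"
        unfolding norm0_def by (rule member_le_sum) (use s in auto)
      ultimately show "k \<in> {k \<in> QN s (N + h). h \<le> norm0 s k}" using k by auto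
    qed
    then have "card (?Q - ?B) \<le> card {k \<in> QN s (N + h). h \<le> norm0 s k}"
      by (intro card_mono) simp_all
    also have "\<dots> \<le> 2 ^ s * Suc (card (QN s N))" by (rule card_QN_norm0_ge)
    also have "\<dots> \<le> 2 ^ s * (2 * card (QN s N))" using Q1 by simp
    finally have G: "card (?Q - ?B) \<le> 2 ^ (s + 1) * card (QN s N)" by simp
    have "card ?Q = card ?B + card (?Q - ?B)"
      using card_Un_disjoint[of ?B "?Q - ?B"] by (simp add: Un_absorb1 Collect_mono_iff)
    then have "card ?Q \<le> 2 * card (?Q - ?B)" using B by linarith
    then show "card ?Q \<le> 2 ^ (s + 2) * card (QN s N)" using G by simp
  qed simp
qed

text \<open>The admissible shift grows with the radius, so the same \<open>h\<close> may be used at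
  every step.\<close>

lemma card_QN_iterate_shift:
  assumes step: "\<And>N h. N0 \<le> N \<Longrightarrow> real h \<le> 3/2 * sqrt (lam * real N / real s) \<Longrightarrow>
    card (QN s (N + h)) \<le> c * card (QN s N)"
    and N: "N0 \<le> N" and h: "real h \<le> 3/2 * sqrt (lam * real N / real s)"
  shows "card (QN s (N + h * i)) \<le> c ^ i * card (QN s N)"
proof (induction i)
  case (Suc i)
  have "real h \<le> 3/2 * sqrt (lam * real (N + h * i) / real s)"
  proof -
    have "sqrt (lam * real N / real s) \<le> sqrt (lam * real (N + h * i) / real s)"
      by (intro real_sqrt_le_mono divide_right_mono mult_left_mono) (auto simp: lam_def)
    then show ?thesis using h by linarith
  qed
  then have "card (QN s ((N + h * i) + h)) \<le> c * card (QN s (N + h * i))"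
    by (intro step) (use N in auto)
  also have "\<dots> \<le> c * (c ^ i * card (QN s N))" using Suc.IH by (rule mult_le_mono2)
  finally show ?case by (simp add: algebra_simps)
qed simp

text \<open>Above \<open>3 * m^2\<close> the ball already has about \<open>2 ^ (2 * m)\<close>
  elements, too many. From below, the exponential count shows that radius about
  \<open>lam * m^2 / (2 * s)\<close> is still admissible. Together these make the set in
  \<open>Nm\<close> finite and nonempty, so its supremum is a maximum.\<close>

lemma Nm_bounds:
  assumes s: "1 \<le> s" and B: "0 < B"
  shows "eventually (\<lambda>m. Nm s B m \<le> 3 * m^2 \<and>
    real (card (QN s (Nm s B m))) \<le> c_s s B * real m * 2 ^ m \<and>
    lam * real m ^ 2 / (2 * real s) < real (Nm s B m) + 1) sequentially"
proof -
  define c where "c = c_s s B"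
  have lam: "lam > 0" by (simp add: lam_def)
  have c: "c > 0" using s B lam by (simp add: c_def c_s_def)
  have "eventually (\<lambda>m::nat. c * real m * 2 ^ m < 2 ^ (2 * m) - 1) sequentially"
    using c by real_asymp
  moreover have "eventually (\<lambda>m::nat. 1 \<le> c * real m) sequentially" using c by real_asymp
  ultimately show ?thesis
  proof eventually_elim
    case (elim m)
    define X where "X = {N. real (card (QN s N)) \<le> c * real m * 2 ^ m}"
    have ub: "N \<le> 3 * m^2" if "N \<in> X" for N
    proof (rule ccontr)
      assume "\<not> N \<le> 3 * m^2"
      then have "(2 * m) * (2 * m + 1) \<le> 2 * N" by (cases m) (auto simp: power2_eq_square algebra_simps)
      from card_QN_ge[OF s this] have "2 ^ (2 * m) \<le> real (card (QN s N)) + 1"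
        by (metis of_nat_Suc of_nat_le_iff of_nat_numeral of_nat_power add.commute)
      then show False using that elim(1) by (simp add: X_def)
    qed
    then have "finite X" using finite_nat_set_iff_bounded_le by blast
    have NmX: "Nm s B m = Sup X" by (simp add: Nm_def X_def c_def)
    \<comment> \<open>Chosen so that the bound \<open>exp (2 * sqrt (s * N1))\<close> is at most
      \<open>2 ^ m\<close>; this uses \<open>2 * lam \<le> (ln 2)^2\<close>, that is, 6 \<le>
      pi^2.\<close>
    define N1 where "N1 = nat \<lfloor>lam * real m ^ 2 / (2 * real s)\<rfloor>"
    have N1: "real N1 \<le> lam * real m ^ 2 / (2 * real s)" "lam * real m ^ 2 / (2 * real s) < real N1 + 1"
      using lam by (auto simp: N1_def)
    have "N1 \<in> X"
    proof -
      have "real (card (QN s N1)) \<le> exp (2 * sqrt (real s * real N1))"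
        using card_norm1_le_exp[of s N1] by simp
      also have "2 * sqrt (real s * real N1) \<le> real m * ln 2"
      proof -
        have "4 * (real s * real N1) \<le> 2 * lam * real m ^ 2"
          using N1(1) s by (simp add: field_simps)
        also have "\<dots> \<le> (ln 2)^2 * real m ^ 2"
        proof (rule mult_right_mono)
          have "(6::real) \<le> pi^2" using pi_gt3 power_mono[of 3 pi 2] by simp
          then show "2 * lam \<le> (ln 2)^2"
            unfolding lam_def by (simp add: field_simps mult_left_mono)
        qed simp
        finally have "sqrt (4 * (real s * real N1)) \<le> sqrt ((real m * ln 2)^2)"
          by (intro real_sqrt_le_mono) (simp add: power_mult_distrib mult.commute)
        then show ?thesis by (simp add: real_sqrt_mult)
      qed
      also have "exp (real m * ln 2) = 2 ^ m" by (simp add: exp_of_nat_mult)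
      also have "(2::real) ^ m \<le> c * real m * 2 ^ m" using elim(2) by simp
      finally show ?thesis by (simp add: X_def)
    qed
    have "Sup X = Max X" using \<open>finite X\<close> \<open>N1 \<in> X\<close> by (metis Sup_nat_def empty_iff)
    then have "Sup X \<in> X" "N1 \<le> Sup X" using \<open>finite X\<close> \<open>N1 \<in> X\<close> Max_in by auto
    then show ?case using ub N1 by (auto simp: NmX X_def c_def)
  qed
qed

section \<open>The random design\<close>

abbreviation coinM :: "bool measure" where
  "coinM \<equiv> measure_pmf (bernoulli_pmf (1/2))"

lemma prob_space_designM: "prob_space designM"
  unfolding designM_def by (rule prob_space_PiM) (rule measure_pmf.prob_space_axioms)

lemma space_designM [simp]: "space designM = UNIV"
  by (simp add: designM_def space_PiM)

lemma measurable_coin [measurable]: "Measurable.pred designM (\<lambda>\<omega>. \<omega> i)"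
proof -
  have "(\<lambda>\<omega>. \<omega> i) \<in> measurable designM coinM"
    unfolding designM_def by (rule measurable_component_singleton) simp
  then show ?thesis by simp
qed

text \<open>Toggling a single coin preserves the measure. This symmetry replaces explicit
  independence arguments for the parity events.\<close>

definition flip :: "design_idx \<Rightarrow> (design_idx \<Rightarrow> bool) \<Rightarrow> design_idx \<Rightarrow> bool" where
  "flip i w = w(i := (\<not> w i))"

lemma flip_measurable [measurable]: "flip i \<in> measurable designM designM"
proof -
  have "(\<lambda>\<omega> n. if n = i then \<not> \<omega> n else \<omega> n) \<in> measurable designM (PiM UNIV (\<lambda>_. coinM))"
    by (rule measurable_abs_UNIV) simp
  moreover have "flip i = (\<lambda>\<omega> n. if n = i then \<not> \<omega> n else \<omega> n)"
    by (auto simp: flip_def fun_eq_iff)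
  ultimately show ?thesis by (simp add: designM_def)
qed

lemma emeasure_coin_Not: "emeasure coinM (Not -` X) = emeasure coinM X"
proof -
  have "map_pmf Not (bernoulli_pmf (1/2)) = bernoulli_pmf (1/2)"
  proof (rule pmf_eqI)
    fix b
    have "pmf (map_pmf Not (bernoulli_pmf (1/2))) (\<not> (\<not> b)) = pmf (bernoulli_pmf (1/2)) (\<not> b)"
      by (rule pmf_map_inj') (auto simp: inj_def)
    then show "pmf (map_pmf Not (bernoulli_pmf (1/2))) b = pmf (bernoulli_pmf (1/2)) b"
      by (cases b) auto
  qed
  then have "emeasure coinM X = emeasure (measure_pmf (map_pmf Not (bernoulli_pmf (1/2)))) X" by simp
  then show ?thesis by (simp only: emeasure_map_pmf)
qed

text \<open>The preimage of a cylinder is the cylinder with its \<open>i\<close>-th factor negated,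
  and a fair coin is invariant under negation; cylinders determine the product measure.\<close>

lemma distr_flip: "distr designM designM (flip i) = designM"
proof -
  interpret product_prob_space "\<lambda>_::design_idx. coinM" UNIV
    by (rule product_prob_spaceI) (rule measure_pmf.prob_space_axioms)
  have "distr designM designM (flip i) = PiM UNIV (\<lambda>_. coinM)"
  proof (rule PiM_eq)
    fix J :: "design_idx set" and F :: "design_idx \<Rightarrow> bool set" assume J: "finite J"
    define F' where "F' = F(i := Not -` F i)"
    let ?emb = "\<lambda>F. prod_emb UNIV (\<lambda>_. coinM) J (\<Pi>\<^sub>E j\<in>J. F j)"
    have s: "?emb F \<in> sets designM" for F
      unfolding designM_def by (rule sets_PiM_I) (use J in auto)
    have "flip i -` ?emb F = ?emb F'"
      by (auto simp: prod_emb_def space_PiM F'_def flip_def PiE_def Pi_def extensional_def split: if_splits)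
    then have "emeasure (distr designM designM (flip i)) (?emb F) = emeasure designM (?emb F')"
      by (simp add: emeasure_distr s)
    also have "\<dots> = (\<Prod>j\<in>J. emeasure coinM (F' j))"
      unfolding designM_def by (rule emeasure_PiM_emb) (use J in auto)
    also have "\<dots> = (\<Prod>j\<in>J. emeasure coinM (F j))"
      by (rule prod.cong) (auto simp: F'_def emeasure_coin_Not)
    finally show "emeasure (distr designM designM (flip i)) (?emb F) = (\<Prod>j\<in>J. emeasure coinM (F j))" .
  qed (simp add: designM_def)
  then show ?thesis by (simp add: designM_def)
qed

lemma measure_flip_vimage:
  "A \<in> sets designM \<Longrightarrow> measure designM (flip i -` A) = measure designM A"
  using measure_distr[OF flip_measurable, of A i] by (simp add: distr_flip)

section \<open>Parity events and survival probabilities\<close>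

lemma measurable_even_card [measurable]:
  "finite D \<Longrightarrow> Measurable.pred designM (\<lambda>\<omega>. even (card {p \<in> D. \<omega> (e p)}))"
proof (induction D rule: finite_induct)
  case (insert q D)
  have "even (card {p \<in> insert q D. \<omega> (e p)}) \<longleftrightarrow> (\<omega> (e q) \<longleftrightarrow> \<not> even (card {p \<in> D. \<omega> (e p)}))" for \<omega>
  proof -
    have "{p \<in> insert q D. \<omega> (e p)} = (if \<omega> (e q) then insert q {p \<in> D. \<omega> (e p)} else {p \<in> D. \<omega> (e p)})"
      by auto
    then show ?thesis using insert.hyps by auto
  qed
  with insert.IH show ?case by simp
qed simp

text \<open>The condition in \<open>Zd\<close> restricted to column \<open>c\<close> of the
  matrices, so that the probability can be computed by induction on the number of columns.\<close>

definition row_even :: "nat \<Rightarrow> (nat \<Rightarrow> nat) \<Rightarrow> nat \<Rightarrow> (design_idx \<Rightarrow> bool) \<Rightarrow> bool" where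
  "row_even s k c \<omega> \<longleftrightarrow> even (card {p \<in> dset s k. \<omega> (Inl (fst p, snd p, c))})"

lemma row_even_measurable [measurable]: "Measurable.pred designM (row_even s k c)"
  unfolding row_even_def by measurable

lemma Zd_eq: "Zd s m k \<omega> = (if \<forall>c<m. row_even s k c \<omega> then 1 else 0)"
proof -
  have "{(j, l). j < s \<and> l \<in> kappa (k j) \<and> \<omega> (Inl (j, l, c))} = {p \<in> dset s k. \<omega> (Inl (fst p, snd p, c))}" for c
    by (auto simp: dset_def)
  then show ?thesis by (simp add: Zd_def row_even_def)
qed

lemma Sd_eq: "Sd s k \<omega> = (if even (card {p \<in> dset s k. \<omega> (Inr p)}) then 1 else -1)"
proof -
  have "{(j, l). j < s \<and> l \<in> kappa (k j) \<and> \<omega> (Inr (j, l))} = {p \<in> dset s k. \<omega> (Inr p)}"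
    by (auto simp: dset_def)
  then show ?thesis by (simp add: Sd_def)
qed

lemma Zd_measurable [measurable]: "Zd s m k \<in> borel_measurable designM"
  unfolding Zd_eq[abs_def] by measurable

lemma Sd_measurable [measurable]: "Sd s k \<in> borel_measurable designM"
  unfolding Sd_eq[abs_def] by measurable

lemma row_even_flip:
  assumes "(j, l) \<in> dset s k"
  shows "row_even s k c (flip (Inl (j, l, c')) \<omega>) \<longleftrightarrow> (row_even s k c \<omega> \<longleftrightarrow> c \<noteq> c')"
proof (cases "c = c'")
  case False
  then show ?thesis by (simp add: row_even_def flip_def)
next
  case True
  let ?A = "{p \<in> dset s k - {(j, l)}. \<omega> (Inl (fst p, snd p, c))}"
  have e: "{p \<in> dset s k. v (Inl (fst p, snd p, c))} = (if v (Inl (j, l, c)) then insert (j, l) ?A else ?A)"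
    if "\<And>p. p \<noteq> (j, l) \<Longrightarrow> v (Inl (fst p, snd p, c)) = \<omega> (Inl (fst p, snd p, c))" for v :: "design_idx \<Rightarrow> bool"
  proof (rule set_eqI)
    fix p
    show "p \<in> {p \<in> dset s k. v (Inl (fst p, snd p, c))} \<longleftrightarrow> p \<in> (if v (Inl (j, l, c)) then insert (j, l) ?A else ?A)"
    proof (cases "p = (j, l)")
      case True
      then show ?thesis using assms by auto
    next
      case False
      then show ?thesis using that[OF False] by auto
    qed
  qed
  have "finite ?A" "(j, l) \<notin> ?A" by auto
  then show ?thesis unfolding row_even_def
    by (subst e[of \<omega>], simp, subst e) (use True in \<open>auto simp: flip_def\<close>)
qed

text \<open>Toggling one selected entry in column \<open>m\<close> exchanges even and odd parity
  there and leaves the earlier columns alone. Each column therefore halves the probability.\<close>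

lemma measure_Zd_eq_1:
  assumes "dset s k \<noteq> {}"
  shows "measure designM {\<omega>. Zd s m k \<omega> = 1} = (1/2) ^ m"
proof -
  interpret prob_space designM by (rule prob_space_designM)
  obtain j l where jl: "(j, l) \<in> dset s k" using assms by auto
  have "prob {\<omega>. \<forall>c<m. row_even s k c \<omega>} = (1/2) ^ m"
  proof (induction m)
    case 0
    show ?case using prob_space by simp
  next
    case (Suc m)
    let ?A = "{\<omega>. \<forall>c<m. row_even s k c \<omega>}" and ?E = "{\<omega>. row_even s k m \<omega>}"
    have "Measurable.pred designM (\<lambda>\<omega>. \<forall>c<m. row_even s k c \<omega>)" "Measurable.pred designM (row_even s k m)"
      by measurable
    then have sets: "?A \<in> sets designM" "?E \<in> sets designM" by (auto simp: pred_def)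
    have "flip (Inl (j, l, m)) -` (?A \<inter> ?E) = ?A - ?E"
      by (auto simp: row_even_flip[OF jl])
    then have "prob (?A \<inter> ?E) = prob (?A - ?E)"
      using measure_flip_vimage[of "?A \<inter> ?E" "Inl (j, l, m)"] sets by auto
    moreover have "prob ?A = prob (?A \<inter> ?E) + prob (?A - ?E)"
      using finite_measure_Union[of "?A \<inter> ?E" "?A - ?E"] sets by (auto simp: Int_Diff_Un)
    ultimately have "prob (?A \<inter> ?E) = (1/2) ^ Suc m" using Suc.IH by simp
    moreover have "?A \<inter> ?E = {\<omega>. \<forall>c<Suc m. row_even s k c \<omega>}" by (auto simp: less_Suc_eq)
    ultimately show ?case by simp
  qed
  moreover have "{\<omega>. Zd s m k \<omega> = 1} = {\<omega>. \<forall>c<m. row_even s k c \<omega>}" by (auto simp: Zd_eq)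
  ultimately show ?thesis by simp
qed

lemma dset_nonempty:
  assumes "k \<in> QN s N" shows "dset s k \<noteq> {}"
proof
  assume "dset s k = {}"
  then have "dset s k = dset s (\<lambda>_. 0)" by (simp add: dset_def)
  then have "k = (\<lambda>_. 0)" using inj_onD[OF inj_on_dset] assms by (auto simp: QN_def)
  then show False using assms by (simp add: QN_def)
qed

lemma measure_Union_Zd_le:
  assumes "X \<subseteq> QN s N"
  shows "measure designM (\<Union>k\<in>X. {\<omega>. Zd s m k \<omega> = 1}) \<le> real (card X) * (1/2) ^ m"
proof -
  interpret prob_space designM by (rule prob_space_designM)
  have X: "finite X" by (rule finite_subset[OF assms finite_QN])
  have sets: "{\<omega>. Zd s m k \<omega> = 1} \<in> sets designM" for k
  proof -
    have "Measurable.pred designM (\<lambda>\<omega>. Zd s m k \<omega> = 1)" by measurable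
    then show ?thesis by (simp add: pred_def)
  qed
  have "prob (\<Union>k\<in>X. {\<omega>. Zd s m k \<omega> = 1}) \<le> (\<Sum>k\<in>X. prob {\<omega>. Zd s m k \<omega> = 1})"
    by (rule finite_measure_subadditive_finite) (use X sets in auto)
  also have "\<dots> = (\<Sum>k\<in>X. (1/2) ^ m)"
    by (intro sum.cong refl measure_Zd_eq_1 dset_nonempty) (use assms in auto)
  finally show ?thesis by simp
qed

text \<open>The balls exhaust the index set, so the unordered sum is a limit of a sequence of finite
  sums. Measurability and bounds pass to it in this form.\<close>

lemma infsum_exhaustion:
  fixes g :: "(nat \<Rightarrow> nat) \<Rightarrow> real"
  assumes X: "X = {k \<in> vecs s. k \<noteq> (\<lambda>_. 0)} - QN s N" and "g summable_on X"
  shows "(\<lambda>n. \<Sum>k\<in>QN s n - QN s N. g k) \<longlonglongrightarrow> infsum g X"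
proof -
  have "filterlim (\<lambda>n. QN s n - QN s N) (finite_subsets_at_top X) sequentially"
    unfolding filterlim_finite_subsets_at_top
  proof (intro allI impI)
    fix F assume F: "finite F \<and> F \<subseteq> X"
    have "F \<subseteq> QN s n - QN s N" if n: "Max (insert 0 (norm1 s ` F)) \<le> n" for n
    proof
      fix k assume k: "k \<in> F"
      then have "norm1 s k \<le> Max (insert 0 (norm1 s ` F))" using F by (intro Max_ge) auto
      then show "k \<in> QN s n - QN s N" using n k F X by (auto simp: QN_def)
    qed
    moreover have "QN s n - QN s N \<subseteq> X" for n unfolding X by (auto simp: QN_def)
    ultimately show "\<forall>\<^sub>F n in sequentially. finite (QN s n - QN s N) \<and> F \<subseteq> QN s n - QN s N \<and> QN s n - QN s N \<subseteq> X"
      unfolding eventually_sequentially by (intro exI[of _ "Max (insert 0 (norm1 s ` F))"]) simp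
  qed
  moreover have "(sum g \<longlongrightarrow> infsum g X) (finite_subsets_at_top X)"
    using has_sum_infsum[OF assms(2)] by (simp add: has_sum_def)
  ultimately show ?thesis by (rule filterlim_compose[rotated])
qed

section \<open>Weights of digit sets\<close>

text \<open>The bound on \<open>fhat\<close> without the factor \<open>K2\<close>: the first factor
  comes from the kernels, the rest from the derivative hypothesis.\<close>

definition weight :: "nat \<Rightarrow> real \<Rightarrow> nat set \<Rightarrow> (nat \<Rightarrow> nat) \<Rightarrow> real" where
  "weight s \<alpha> J k = (1/2) ^ norm1 s k * (\<alpha> ^ norm0 s k * (\<Prod>j\<in>J. fact (card (kappa (k j)))))"

lemma weight_nonneg: "0 < \<alpha> \<Longrightarrow> 0 \<le> weight s \<alpha> J k"
  by (auto simp: weight_def intro!: mult_nonneg_nonneg prod_nonneg)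

text \<open>Each factorial is estimated by n! \<le> n^n \<le> x^y. Keeping \<open>x\<close> apart
  from \<open>y\<close> allows a crude base inside the logarithm together with a sharp digit count
  in front of it.\<close>

lemma weight_le_powr:
  assumes J: "J \<subseteq> {..<s}" and \<alpha>: "0 < \<alpha>" "\<alpha> \<le> b" "1 \<le> b"
    and y: "\<And>j. j < s \<Longrightarrow> real (card (kappa (k j))) \<le> y" "y \<le> x" "1 \<le> x"
  shows "weight s \<alpha> J k \<le> 2 powr (- real (norm1 s k) + y * (real s * log 2 b + real (card J) * log 2 x))"
proof -
  have "real (norm0 s k) \<le> (\<Sum>j<s. y)"
    unfolding norm0_def of_nat_sum by (rule sum_mono) (use y(1) in simp)
  then have n0: "real (norm0 s k) \<le> real s * y" by simp
  have "\<alpha> ^ norm0 s k \<le> b ^ norm0 s k" using \<alpha> by (intro power_mono) auto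
  also have "\<dots> = b powr real (norm0 s k)" using \<alpha> by (simp add: powr_realpow)
  also have "\<dots> \<le> b powr (real s * y)" using n0 \<alpha> by (intro powr_mono) auto
  also have "\<dots> = 2 powr (y * (real s * log 2 b))"
    using \<alpha> by (simp add: powr_def log_def mult_ac)
  finally have 1: "\<alpha> ^ norm0 s k \<le> 2 powr (y * (real s * log 2 b))" .
  have "(\<Prod>j\<in>J. fact (card (kappa (k j)))) \<le> (\<Prod>j\<in>J. x powr y)"
  proof (rule prod_mono, intro conjI)
    fix j assume "j \<in> J"
    then have n: "real (card (kappa (k j))) \<le> y" using J y(1) by auto
    have "(fact (card (kappa (k j))) :: real) \<le> real (card (kappa (k j))) ^ card (kappa (k j))"
      by (metis fact_le_power order_refl of_nat_power)
    also have "\<dots> \<le> x ^ card (kappa (k j))" using n y by (intro power_mono) auto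
    also have "\<dots> = x powr real (card (kappa (k j)))" using y by (simp add: powr_realpow)
    also have "\<dots> \<le> x powr y" using n y by (intro powr_mono) auto
    finally show "fact (card (kappa (k j))) \<le> x powr y" .
  qed simp
  also have "\<dots> = 2 powr (y * (real (card J) * log 2 x))"
    using y by (simp add: powr_def log_def mult_ac exp_of_nat_mult[symmetric])
  finally have 2: "(\<Prod>j\<in>J. fact (card (kappa (k j)))) \<le> 2 powr (y * (real (card J) * log 2 x))" .
  have 3: "(1/2 :: real) ^ norm1 s k = 2 powr (- real (norm1 s k))"
    by (simp add: powr_minus powr_realpow power_one_over inverse_eq_divide)
  have "weight s \<alpha> J k \<le> 2 powr (- real (norm1 s k)) * (2 powr (y * (real s * log 2 b)) * 2 powr (y * (real (card J) * log 2 x)))"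
    unfolding weight_def 3 using 1 2 \<alpha> by (intro mult_left_mono mult_mono) (auto intro!: prod_nonneg)
  then show ?thesis by (simp add: powr_add[symmetric] algebra_simps)
qed

section \<open>Weight of a single norm level and of the tail\<close>

lemma card_kappa_le_sqrt:
  assumes "j < s" shows "real (card (kappa (k j))) \<le> sqrt (2 * real (norm1 s k))"
proof -
  have "\<Sum>(kappa (k j)) \<le> norm1 s k"
    unfolding norm1_def by (rule member_le_sum[where f="\<lambda>j. \<Sum>(kappa (k j))"]) (use assms in auto)
  then have "(card (kappa (k j)))^2 \<le> 2 * norm1 s k"
    using card_kappa_le_sum[of "k j"] by (simp add: power2_eq_square)
  then have "real (card (kappa (k j))) ^ 2 \<le> 2 * real (norm1 s k)"
    by (metis of_nat_le_iff of_nat_mult of_nat_numeral of_nat_power)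
  then show ?thesis by (rule real_le_rsqrt)
qed

text \<open>Every coordinate is given the worst-case digit count \<open>sqrt (2 * M)\<close>. The
  number of terms and the growth of the derivatives then cost only order sqrt M * log M in the
  exponent, against the gain \<open>- M\<close>.\<close>

lemma sum_weight_level_le:
  assumes s: "1 \<le> s" and J: "J \<subseteq> {..<s}" and \<alpha>: "0 < \<alpha>" "\<alpha> \<le> b" "1 \<le> b" and M: "1 \<le> M"
  shows "(\<Sum>k\<in>{k \<in> QN s n. norm1 s k = M}. weight s \<alpha> J k)
    \<le> 2 powr (- real M + real s * sqrt (2 * real M) * (log 2 b + 3 + log 2 (sqrt (2 * real M))))"
proof -
  define r where "r = sqrt (2 * real M)"
  have r: "1 \<le> r" using M by (simp add: r_def)
  have lr: "0 \<le> log 2 r" using r by simp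
  let ?X = "{k \<in> QN s n. norm1 s k = M}"
  have cJ: "real (card J) \<le> real s" using card_mono[OF _ J] by simp
  have w: "weight s \<alpha> J k \<le> 2 powr (- real M + r * (real s * log 2 b + real s * log 2 r))" if "k \<in> ?X" for k
  proof -
    have "weight s \<alpha> J k \<le> 2 powr (- real (norm1 s k) + r * (real s * log 2 b + real (card J) * log 2 r))"
      by (rule weight_le_powr[OF J \<alpha>]) (use card_kappa_le_sqrt[of _ s k] that r in \<open>auto simp: r_def\<close>)
    also have "\<dots> \<le> 2 powr (- real M + r * (real s * log 2 b + real s * log 2 r))"
      using that r lr cJ by (intro powr_mono add_mono mult_left_mono mult_right_mono) auto
    finally show ?thesis .
  qed
  have "card ?X \<le> card (QN s M)" by (rule card_mono[OF finite_QN]) (auto simp: QN_def)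
  then have "real (card ?X) \<le> exp (2 * sqrt (real s * real M))"
    using card_norm1_le_exp[of s M] by simp
  \<comment> \<open>The constant 3 turns base e into base 2: 2 \<le> 3 * ln 2.\<close>
  also have "\<dots> \<le> 2 powr (3 * (real s * r))"
  proof -
    have "2 * sqrt (real s * real M) \<le> 2 * (real s * r)"
    proof -
      have "sqrt (real s) \<le> real s" using s real_sqrt_le_iff[of "real s" "real s ^ 2"] by (simp add: power2_eq_square)
      moreover have "sqrt (real M) \<le> r" by (simp add: r_def)
      ultimately show ?thesis unfolding real_sqrt_mult by (intro mult_left_mono mult_mono) auto
    qed
    also have "\<dots> \<le> (3 * ln 2) * (real s * r)"
      using ln2_ge_two_thirds r by (intro mult_right_mono) auto
    finally show ?thesis by (simp add: powr_def mult_ac)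
  qed
  finally have c: "real (card ?X) \<le> 2 powr (3 * (real s * r))" .
  have "(\<Sum>k\<in>?X. weight s \<alpha> J k) \<le> real (card ?X) * 2 powr (- real M + r * (real s * log 2 b + real s * log 2 r))"
    by (rule sum_bounded_above) (rule w)
  also have "\<dots> \<le> 2 powr (3 * (real s * r)) * 2 powr (- real M + r * (real s * log 2 b + real s * log 2 r))"
    using c by (rule mult_right_mono) simp
  also have "\<dots> = 2 powr (- real M + real s * r * (log 2 b + 3 + log 2 r))"
    by (simp add: powr_add[symmetric] algebra_simps)
  finally show ?thesis unfolding r_def .
qed

text \<open>The hypothesis lets the loss at level \<open>M\<close> use up at most half of
  \<open>M - N\<close>. Levels then decay at the ratio 2^(-1/2) \<le> 3/4, and the geometric series
  sums to 4.\<close>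

lemma sum_weight_tail_le:
  assumes s: "1 \<le> s" and J: "J \<subseteq> {..<s}" and \<alpha>: "0 < \<alpha>" "\<alpha> \<le> b" "1 \<le> b" and N: "N \<le> N'"
    and tail: "\<And>M. N' < M \<Longrightarrow>
      real s * sqrt (2 * real M) * (log 2 b + 3 + log 2 (sqrt (2 * real M))) \<le> (real M - real N) / 2"
  shows "(\<Sum>k\<in>QN s n - QN s N'. weight s \<alpha> J k) \<le> 4 * 2 powr (- real N)"
proof -
  let ?S = "QN s n - QN s N'"
  have "(\<Sum>k\<in>?S. weight s \<alpha> J k) = (\<Sum>M\<in>{N'<..n}. \<Sum>k\<in>{k \<in> ?S. norm1 s k = M}. weight s \<alpha> J k)"
    by (rule sum.group[symmetric]) (auto simp: QN_def finite_QN[unfolded QN_def])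
  also have "\<dots> \<le> (\<Sum>M\<in>{N'<..n}. 2 powr (- real N) * (3/4) ^ (M - N))"
  proof (rule sum_mono)
    fix M assume M: "M \<in> {N'<..n}"
    have "(\<Sum>k\<in>{k \<in> ?S. norm1 s k = M}. weight s \<alpha> J k) \<le> (\<Sum>k\<in>{k \<in> QN s n. norm1 s k = M}. weight s \<alpha> J k)"
      by (rule sum_mono2) (auto intro: weight_nonneg[OF \<alpha>(1)])
    also have "\<dots> \<le> 2 powr (- real M + real s * sqrt (2 * real M) * (log 2 b + 3 + log 2 (sqrt (2 * real M))))"
      by (rule sum_weight_level_le[OF s J \<alpha>]) (use M in auto)
    also have "\<dots> \<le> 2 powr (- real M + (real M - real N) / 2)"
      using tail[of M] M by (intro powr_mono) auto
    also have "- real M + (real M - real N) / 2 = - real N + (-1/2) * real (M - N)"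
      using M N by (simp add: field_simps of_nat_diff)
    also have "2 powr (- real N + (-1/2) * real (M - N)) = 2 powr (- real N) * (2 powr (-1/2)) ^ (M - N)"
      by (simp only: powr_add powr_powr[symmetric]) (simp add: powr_realpow)
    also have "\<dots> \<le> 2 powr (- real N) * (3/4) ^ (M - N)"
    proof (intro mult_left_mono power_mono)
      have "(2::real) powr (-1/2) = 1 / sqrt 2" by (simp add: powr_minus powr_half_sqrt field_simps)
      also have "\<dots> \<le> 3/4"
      proof -
        have "4/3 \<le> sqrt 2" by (rule real_le_rsqrt) (simp add: power2_eq_square)
        then show ?thesis by (simp add: field_simps)
      qed
      finally show "(2::real) powr (-1/2) \<le> 3/4" .
    qed auto
    finally show "(\<Sum>k\<in>{k \<in> ?S. norm1 s k = M}. weight s \<alpha> J k) \<le> 2 powr (- real N) * (3/4) ^ (M - N)" .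
  qed
  also have "\<dots> = 2 powr (- real N) * (\<Sum>M\<in>{N'<..n}. (3/4) ^ (M - N))" by (simp add: sum_distrib_left)
  also have "(\<Sum>M\<in>{N'<..n}. (3/4::real) ^ (M - N)) = (\<Sum>i\<in>(\<lambda>M. M - N) ` {N'<..n}. (3/4) ^ i)"
    by (subst sum.reindex) (use N in \<open>auto simp: inj_on_def\<close>)
  also have "\<dots> \<le> (\<Sum>i. (3/4) ^ i)"
    by (rule sum_le_suminf) (auto intro!: summable_geometric)
  also have "\<dots> = 4" by (subst suminf_geometric) auto
  finally show ?thesis by simp
qed

text \<open>Split on the excess x = M - N. If x \<le> m^2, then M \<le> 4 * m^2, so
  \<open>sqrt (2 * M)\<close> is at most \<open>3 * m\<close> and the left side at most
  \<open>6 * s * m * log 2 m\<close>; this explains the constant 12. Otherwise M \<le> 4 * x, and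
  sqrt x * log x is negligible against x.\<close>

lemma tail_exponent_eventually:
  fixes s :: nat and \<beta> :: real
  assumes s: "1 \<le> s"
  shows "eventually (\<lambda>m::nat. \<forall>N M. N \<le> 3 * m^2 \<longrightarrow> N \<le> M \<longrightarrow> 1 \<le> M \<longrightarrow>
      12 * real s * real m * log 2 (real m) \<le> real M - real N \<longrightarrow>
      real s * sqrt (2 * real M) * (\<beta> + log 2 (sqrt (2 * real M))) \<le> (real M - real N) / 2) sequentially"
proof -
  have "eventually (\<lambda>x::real. real s * (3 * sqrt x) * (\<bar>\<beta>\<bar> + log 2 (3 * sqrt x)) \<le> x / 2) at_top"
    by real_asymp
  then obtain X0 where X0: "\<And>x. x \<ge> X0 \<Longrightarrow> real s * (3 * sqrt x) * (\<bar>\<beta>\<bar> + log 2 (3 * sqrt x)) \<le> x / 2"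
    by (auto simp: eventually_at_top_linorder)
  have "eventually (\<lambda>m::nat. X0 \<le> real m ^ 2) sequentially" by real_asymp
  moreover have "eventually (\<lambda>m::nat. \<bar>\<beta>\<bar> + log 2 (3 * real m) \<le> 2 * log 2 (real m)) sequentially"
    by real_asymp
  moreover have "eventually (\<lambda>m::nat. 1 \<le> m) sequentially" by (rule eventually_ge_at_top)
  ultimately show ?thesis
  proof eventually_elim
    case (elim m)
    show ?case
    proof (intro allI impI)
      fix N M :: nat assume N: "N \<le> 3 * m^2" "N \<le> M" "1 \<le> M"
        and x: "12 * real s * real m * log 2 (real m) \<le> real M - real N"
      have Nr: "real N \<le> 3 * real m ^ 2" using N(1) by (metis of_nat_le_iff of_nat_mult of_nat_numeral of_nat_power)
      have mono: "real s * sqrt (2 * real M) * (\<beta> + log 2 (sqrt (2 * real M))) \<le> real s * z * (\<bar>\<beta>\<bar> + log 2 z)"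
        if z: "2 * real M \<le> z ^ 2" "0 \<le> z" for z
      proof -
        have sz: "sqrt (2 * real M) \<le> z" using z by (intro real_le_lsqrt) auto
        have s1: "1 \<le> sqrt (2 * real M)" using N by simp
        have "log 2 (sqrt (2 * real M)) \<le> log 2 z" using sz s1 by (intro log_mono) linarith+
        moreover have "0 \<le> log 2 z" using sz s1 by (subst zero_le_log_cancel_iff) linarith+
        ultimately have "real s * sqrt (2 * real M) * (\<beta> + log 2 (sqrt (2 * real M))) \<le> real s * sqrt (2 * real M) * (\<bar>\<beta>\<bar> + log 2 z)"
          using s1 by (intro mult_left_mono) auto
        also have "\<dots> \<le> real s * z * (\<bar>\<beta>\<bar> + log 2 z)"
          using sz \<open>0 \<le> log 2 z\<close> by (intro mult_right_mono mult_left_mono) auto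
        finally show ?thesis .
      qed
      show "real s * sqrt (2 * real M) * (\<beta> + log 2 (sqrt (2 * real M))) \<le> (real M - real N) / 2"
      proof (cases "real M - real N \<le> real m ^ 2")
        case True
        have "real s * sqrt (2 * real M) * (\<beta> + log 2 (sqrt (2 * real M))) \<le> real s * (3 * real m) * (\<bar>\<beta>\<bar> + log 2 (3 * real m))"
          by (rule mono) (use True Nr in \<open>auto simp: power_mult_distrib\<close>)
        also have "\<dots> \<le> real s * (3 * real m) * (2 * log 2 (real m))"
          using elim(2) by (intro mult_left_mono) auto
        also have "\<dots> \<le> (real M - real N) / 2" using x by simp
        finally show ?thesis .
      next
        case False
        define x where "x = real M - real N"
        have x0: "0 \<le> x" using N by (simp add: x_def)
        have "real s * sqrt (2 * real M) * (\<beta> + log 2 (sqrt (2 * real M))) \<le> real s * (3 * sqrt x) * (\<bar>\<beta>\<bar> + log 2 (3 * sqrt x))"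
          by (rule mono) (use False Nr x0 in \<open>auto simp: power_mult_distrib x_def\<close>)
        also have "\<dots> \<le> x / 2" by (rule X0) (use False elim(1) in \<open>auto simp: x_def\<close>)
        finally show ?thesis by (simp add: x_def)
      qed
    qed
  qed
qed

section \<open>The truncated Walsh series\<close>

lemma lam_bounds: "0 < lam" "lam \<le> 1/3"
proof -
  show "0 < lam" by (simp add: lam_def)
  have "(9::real) \<le> pi^2" using pi_gt3 power_mono[of 3 pi 2] by simp
  moreover have "(ln 2)^2 \<le> (1::real)" using ln_2_less_1 by (simp add: power_le_one)
  ultimately show "lam \<le> 1/3" by (simp add: lam_def field_simps)
qed

text \<open>\<open>N'\<close> is reached from \<open>N\<close> by about \<open>C * log 2 m\<close>
  shifts of length about \<open>T\<close>. Each shift multiplies the size of the ball by a constant,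
  hence all of them by a power of \<open>m\<close>, while the total excess is of order m * log m and
  changes \<open>T\<close> only by order log m.\<close>

lemma enlarged_radius:
  fixes s :: nat and A' B B' a C :: real
  assumes s: "1 \<le> s" and AB: "AB'_hyp s A' B'" and B: "0 < B"
    and a: "a = lam / (2 * real s)" and C: "C = 24 * real s / a"
  shows "eventually (\<lambda>m. \<exists>N'. Nm s B m < N' \<and> real N' \<le> 4 * real m ^ 2 \<and> a * real m ^ 2 \<le> real N' \<and>
     12 * real s * real m * log 2 (real m) \<le> real N' - real (Nm s B m) \<and>
     real (card (QN s N')) \<le> 2 powr ((real s + 2) * (C * log 2 (real m) + 1)) * (c_s s B * real m * 2 ^ m) \<and>
     sqrt (lam * real N' / real s) \<le> sqrt (lam * real (Nm s B m) / real s) + a * (C * log 2 (real m) + 1) \<and>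
     a * real m \<le> sqrt (lam * real (Nm s B m) / real s) \<and> Nm s B m \<le> 3 * m^2) sequentially"
proof -
  have a0: "0 < a" using s lam_bounds by (simp add: a)
  have C0: "0 < C" using s a0 by (simp add: C)
  obtain N0 where N0: "\<And>N h. N0 \<le> N \<Longrightarrow> real h \<le> 3/2 * sqrt (lam * real N / real s) \<Longrightarrow>
    card (QN s (N + h)) \<le> 2 ^ (s + 2) * card (QN s N)"
    using card_QN_shift[OF s AB] by blast
  have "eventually (\<lambda>m::nat. 2 \<le> a * real m ^ 2) sequentially" using a0 by real_asymp
  moreover have "eventually (\<lambda>m::nat. 2 \<le> a * real m) sequentially" using a0 by real_asymp
  moreover have "eventually (\<lambda>m::nat. C * log 2 (real m) + 1 \<le> real m) sequentially" using C0 by real_asymp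
  moreover have "eventually (\<lambda>m::nat. real N0 + 1 \<le> a * real m ^ 2) sequentially" using a0 by real_asymp
  moreover have "eventually (\<lambda>m::nat. 2 \<le> m) sequentially" by (rule eventually_ge_at_top)
  moreover note Nm_bounds[OF s B]
  ultimately show ?thesis
  proof eventually_elim
    case (elim m)
    define N L T where "N = Nm s B m" and "L = log 2 (real m)" and "T = sqrt (lam * real N / real s)"
    have N: "N \<le> 3 * m^2" "real (card (QN s N)) \<le> c_s s B * real m * 2 ^ m" "a * real m ^ 2 < real N + 1"
      using elim(6) by (auto simp: N_def a)
    have Nr: "real N \<le> 3 * real m ^ 2"
      using of_nat_mono[OF N(1), where 'a=real] by simp
    have L1: "1 \<le> L" using elim(5) by (simp add: L_def)
    have T2: "T ^ 2 = 2 * a * real N" using lam_bounds s by (simp add: T_def a)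
    have T0: "0 \<le> T" using lam_bounds by (simp add: T_def)
    have Tlow: "a * real m \<le> T"
    proof -
      have "a * real m ^ 2 / 2 \<le> real N" using N(3) elim(1) by simp
      then have "2 * a * (a * real m ^ 2 / 2) \<le> 2 * a * real N" using a0 by (intro mult_left_mono) auto
      moreover have "2 * a * (a * real m ^ 2 / 2) = (a * real m)^2" by (simp add: power2_eq_square)
      ultimately have "(a * real m)^2 \<le> T^2" by (simp only: T2)
      then show ?thesis using T0 by (rule power2_le_imp_le)
    qed
    have Thigh: "T \<le> real m"
    proof -
      have "2 * a \<le> lam" using s lam_bounds by (simp add: a field_simps)
      then have "2 * a \<le> 1/3" using lam_bounds by linarith
      then have "2 * a * real N \<le> 1/3 * (3 * real m ^ 2)" using Nr a0 by (intro mult_mono) auto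
      then have "T^2 \<le> (real m)^2" by (simp add: T2)
      then show ?thesis by (rule power2_le_imp_le) simp
    qed
    \<comment> \<open>The value of \<open>C\<close> is fixed by \<open>hi_low\<close>: with
      \<open>h\<close> at least \<open>a * m / 2\<close>, taking \<open>C * L\<close> shifts yields
      exactly the excess \<open>12 * s * m * L\<close> that the tail estimate requires.\<close>
    define h i where "h = nat \<lfloor>T\<rfloor>" and "i = nat \<lceil>C * L\<rceil>"
    have h: "real h \<le> T" "T - 1 \<le> real h" using T0 of_int_floor_le[of T] floor_correct[of T] by (simp_all add: h_def)
    have CL: "0 \<le> C * L" using C0 L1 by simp
    have i: "C * L \<le> real i" "real i \<le> C * L + 1" using CL ceiling_correct[of "C * L"] by (simp_all add: i_def)
    have hi: "real (h * i) = real h * real i" by simp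
    have hi_low: "12 * real s * real m * L \<le> real (h * i)"
    proof -
      have "a * real m / 2 \<le> real h" using h(2) Tlow elim(2) by linarith
      then have "(a * real m / 2) * (C * L) \<le> real h * real i" using i(1) a0 CL by (intro mult_mono) auto
      moreover have "(a * real m / 2) * (C * L) = 12 * real s * real m * L" using a0 by (simp add: C)
      ultimately show ?thesis by (simp only: hi)
    qed
    have hi_high: "real (h * i) \<le> T * (C * L + 1)"
      unfolding hi using h i T0 by (intro mult_mono) auto
    have hi_pos: "0 < h * i"
    proof -
      have "0 < 12 * real s * real m * L" using s L1 elim(5) by simp
      then have "0 < real (h * i)" using hi_low by linarith
      then show ?thesis by (simp only: of_nat_0_less_iff)
    qed
    have "T * (C * L + 1) \<le> real m * real m" using Thigh elim(3) CL by (intro mult_mono) (auto simp: L_def)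
    then have N'4: "real (N + h * i) \<le> 4 * real m ^ 2"
      using hi_high Nr by (simp add: power2_eq_square)
    \<comment> \<open>Completing the square, with \<open>T^2 = 2 * a * N\<close>.\<close>
    have sq: "sqrt (lam * real (N + h * i) / real s) \<le> T + a * (C * L + 1)"
    proof (rule real_le_lsqrt)
      have "lam * real (N + h * i) / real s = T^2 + 2 * a * real (h * i)"
        using s by (simp add: T2 a field_simps)
      also have "\<dots> \<le> T^2 + 2 * a * (T * (C * L + 1))" using hi_high a0 by simp
      also have "\<dots> \<le> T^2 + 2 * a * (T * (C * L + 1)) + (a * (C * L + 1))^2" by simp
      also have "\<dots> = (T + a * (C * L + 1))^2" by (simp add: power2_sum)
      finally show "lam * real (N + h * i) / real s \<le> (T + a * (C * L + 1))^2" .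
    qed (use T0 a0 CL in auto)
    have "card (QN s (N + h * i)) \<le> (2 ^ (s + 2)) ^ i * card (QN s N)"
    proof (rule card_QN_iterate_shift[OF N0])
      have "real N0 \<le> real N" using N(3) elim(4) by linarith
      then show "N0 \<le> N" by simp
      show "real h \<le> 3/2 * sqrt (lam * real N / real s)" using h(1) T0 by (simp add: T_def)
    qed auto
    then have "real (card (QN s (N + h * i))) \<le> (2 ^ (s + 2)) ^ i * real (card (QN s N))"
      using of_nat_mono[where 'a=real] by fastforce
    also have "\<dots> \<le> 2 powr ((real s + 2) * (C * L + 1)) * (c_s s B * real m * 2 ^ m)"
    proof (rule mult_mono)
      have "((2::real) ^ (s + 2)) ^ i = 2 powr ((real s + 2) * real i)"
      proof -
        have "((2::real) ^ (s + 2)) ^ i = 2 ^ ((s + 2) * i)" by (simp only: power_mult)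
        also have "\<dots> = 2 powr real ((s + 2) * i)" by (rule powr_realpow[symmetric]) simp
        also have "real ((s + 2) * i) = (real s + 2) * real i" by (simp add: algebra_simps)
        finally show ?thesis .
      qed
      also have "\<dots> \<le> 2 powr ((real s + 2) * (C * L + 1))" using i(2) by (intro powr_mono mult_left_mono) auto
      finally show "((2::real) ^ (s + 2)) ^ i \<le> 2 powr ((real s + 2) * (C * L + 1))" .
    qed (use N(2) in auto)
    finally have cQ: "real (card (QN s (N + h * i))) \<le> 2 powr ((real s + 2) * (C * L + 1)) * (c_s s B * real m * 2 ^ m)" .
    have "a * real m ^ 2 \<le> real (N + h * i)" 
    proof -
      have "1 \<le> h * i" using hi_pos by linarith
      then have "1 \<le> real (h * i)" using of_nat_mono[of 1 "h * i", where 'a=real] by (simp only: of_nat_1)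
      then show ?thesis unfolding of_nat_add using N(3) by linarith
    qed
    with hi_pos N'4 hi_low cQ sq Tlow N(1) show ?case
      unfolding N_def[symmetric] L_def[symmetric] T_def[symmetric]
      by (intro exI[of _ "N + h * i"]) auto
  qed
qed

definition atypical :: "nat \<Rightarrow> nat \<Rightarrow> real \<Rightarrow> (nat \<Rightarrow> nat) set" where
  "atypical s N \<epsilon> = {k \<in> QN s N. \<exists>j<s. \<bar>real (card (kappa (k j))) / sqrt (lam * real N / real s) - 2\<bar> > \<epsilon>}"

text \<open>Union bound over the coordinates.\<close>

lemma card_atypical_le:
  assumes s: "1 \<le> s" and AB: "AB'_hyp s A' B'" and N: "1 \<le> N" and \<epsilon>: "0 < \<epsilon>" "\<epsilon> < 1"
  shows "real (card (atypical s N \<epsilon>)) \<le>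
    real s * (A' * real N powr (1/4) * exp (- B' * \<epsilon>^2 * sqrt (real N)) * real (card (QN s N)))"
proof -
  let ?X = "\<lambda>j. {k \<in> QN s N. \<bar>real (card (kappa (k j))) / sqrt (lam * real N / real s) - 2\<bar> > \<epsilon>}"
  let ?p = "A' * real N powr (1/4) * exp (- B' * \<epsilon>^2 * sqrt (real N))"
  have Q: "0 < card (QN s N)" using card_QN_ge[OF s, of 1 N] N by simp
  have X: "real (card (?X j)) \<le> ?p * real (card (QN s N))" if "j < s" for j
  proof -
    have "\<forall>N::nat. \<forall>j<s. \<forall>\<epsilon>::real. 1 \<le> N \<longrightarrow> 0 < \<epsilon> \<longrightarrow> \<epsilon> < 1 \<longrightarrow>
        real (card {k \<in> QN s N. \<bar>real (card (kappa (k j))) / sqrt (lam * real N / real s) - 2\<bar> > \<epsilon>})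
          / real (card (QN s N)) \<le> A' * real N powr (1/4) * exp (- B' * \<epsilon>^2 * sqrt (real N))"
      using AB unfolding AB'_hyp_def by blast
    from this[rule_format, OF that N \<epsilon>] have "real (card (?X j)) / real (card (QN s N)) \<le> ?p" .
    then show ?thesis using Q by (simp add: pos_divide_le_eq)
  qed
  have "atypical s N \<epsilon> = (\<Union>j<s. ?X j)" by (auto simp: atypical_def)
  then have "card (atypical s N \<epsilon>) \<le> (\<Sum>j<s. card (?X j))" using card_UN_le[of "{..<s}" ?X] by simp
  then have "real (card (atypical s N \<epsilon>)) \<le> (\<Sum>j<s. real (card (?X j)))"
    unfolding of_nat_sum[symmetric] of_nat_le_iff .
  also have "\<dots> \<le> (\<Sum>j<s. ?p * real (card (QN s N)))" by (rule sum_mono) (use X in auto)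
  finally show ?thesis by simp
qed

section \<open>Domination, convergence and measurability of the series\<close>

lemma fhat_le_weight:
  assumes f: "smooth_cube s f" and k: "k \<in> vecs s" and \<alpha>: "0 < \<alpha>" and K2: "0 < K2"
    and mix: "\<forall>k\<in>vecs s. (\<integral>\<^sup>+ x. ennreal \<bar>mixed s (\<lambda>j. card (kappa (k j))) f x\<bar> \<partial>cubeM s)
          \<le> ennreal (K2 * \<alpha> ^ norm0 s k * (\<Prod>j\<in>J. fact (card (kappa (k j)))))"
  shows "\<bar>fhat s f k\<bar> \<le> K2 * weight s \<alpha> J k"
  using abs_fhat_le[OF f mix[rule_format, OF k]] \<alpha> K2
  by (simp add: weight_def mult_ac prod_nonneg)

context
  fixes s :: nat and B \<alpha> K2 t :: real and J :: "nat set" and f :: "(nat \<Rightarrow> real) \<Rightarrow> real" and m N' :: nat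
  assumes \<alpha>: "0 < \<alpha>" and K2: "0 < K2"
    and fw: "\<And>k. k \<in> vecs s \<Longrightarrow> \<bar>fhat s f k\<bar> \<le> K2 * weight s \<alpha> J k"
    and tail: "\<And>n. (\<Sum>k\<in>QN s n - QN s N'. weight s \<alpha> J k) \<le> t"
begin

text \<open>Any finite set of indices lies in the ball of radius \<open>N'\<close> together with a
  finite shell beyond it, so the uniform shell bound \<open>t\<close> gives absolute summability for
  every design.\<close>

lemma summable_SUM2:
  "(\<lambda>k. Zd s m k \<omega> * Sd s k \<omega> * fhat s f k) summable_on {k \<in> vecs s. k \<noteq> (\<lambda>_. 0)} - QN s N"
proof -
  let ?X = "{k \<in> vecs s. k \<noteq> (\<lambda>_. 0)} - QN s N"
  note w0 = weight_nonneg[OF \<alpha>, of s J]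
  have "(\<lambda>k. K2 * weight s \<alpha> J k) summable_on ?X"
  proof (rule nonneg_bdd_above_summable_on)
    show "bdd_above (sum (\<lambda>k. K2 * weight s \<alpha> J k) ` {F. F \<subseteq> ?X \<and> finite F})"
    proof (rule bdd_aboveI2)
      fix F assume F: "F \<in> {F. F \<subseteq> ?X \<and> finite F}"
      define n where "n = Max (insert 0 (norm1 s ` F))"
      have "F \<subseteq> QN s N' \<union> (QN s n - QN s N')"
      proof
        fix k assume k: "k \<in> F"
        then have "norm1 s k \<le> n" unfolding n_def using F by (intro Max_ge) auto
        then show "k \<in> QN s N' \<union> (QN s n - QN s N')" using k F by (auto simp: QN_def)
      qed
      then have "sum (weight s \<alpha> J) F \<le> sum (weight s \<alpha> J) (QN s N' \<union> (QN s n - QN s N'))"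
        by (intro sum_mono2) (auto intro: w0)
      also have "\<dots> = sum (weight s \<alpha> J) (QN s N') + sum (weight s \<alpha> J) (QN s n - QN s N')"
        by (rule sum.union_disjoint) auto
      also have "\<dots> \<le> sum (weight s \<alpha> J) (QN s N') + t" using tail[of n] by simp
      finally show "(\<Sum>k\<in>F. K2 * weight s \<alpha> J k) \<le> K2 * (sum (weight s \<alpha> J) (QN s N') + t)"
        using K2 by (simp add: sum_distrib_left[symmetric])
    qed
  qed (use K2 w0 in auto)
  then have "(\<lambda>k. norm (Zd s m k \<omega> * Sd s k \<omega> * fhat s f k)) summable_on ?X"
  proof (rule Infinite_Sum.abs_summable_on_comparison_test')
    fix k assume "k \<in> ?X"
    then have "\<bar>fhat s f k\<bar> \<le> K2 * weight s \<alpha> J k" using fw by simp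
    then show "norm (Zd s m k \<omega> * Sd s k \<omega> * fhat s f k) \<le> K2 * weight s \<alpha> J k"
      using mult_nonneg_nonneg[OF less_imp_le[OF K2] w0] by (simp add: Zd_eq Sd_eq abs_mult)
  qed
  then show ?thesis by (rule abs_summable_summable)
qed

lemma SUM2_limit:
  "(\<lambda>n. \<Sum>k\<in>QN s n - QN s (Nm s B m). Zd s m k \<omega> * Sd s k \<omega> * fhat s f k) \<longlonglongrightarrow> SUM2 s B m f \<omega>"
  unfolding SUM2_def by (rule infsum_exhaustion[OF refl summable_SUM2])

lemma SUM2_measurable: "SUM2 s B m f \<in> borel_measurable designM"
  by (rule borel_measurable_LIMSEQ_real[OF SUM2_limit]) measurable

text \<open>Terms in \<open>X\<close> vanish because \<open>Zd\<close> takes only the values 0 and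
  1. The others are at most \<open>K2 * weight\<close>: those up to \<open>N'\<close> add up to at
  most \<open>K2 * u\<close>, those beyond it to at most \<open>K2 * t\<close>.\<close>

lemma abs_SUM2_le:
  assumes N: "Nm s B m \<le> N'" and bad: "\<And>k. k \<in> X \<Longrightarrow> Zd s m k \<omega> \<noteq> 1"
    and mid: "(\<Sum>k\<in>QN s N' - QN s (Nm s B m) - X. weight s \<alpha> J k) \<le> u"
  shows "\<bar>SUM2 s B m f \<omega>\<bar> \<le> K2 * (u + t)"
proof (rule LIMSEQ_le_const2[OF tendsto_rabs[OF SUM2_limit]], intro exI[of _ N'] allI impI)
  fix n assume n: "N' \<le> n"
  let ?N = "Nm s B m"
  let ?g = "\<lambda>k. if k \<in> X then 0 else K2 * weight s \<alpha> J k"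
  note w0 = weight_nonneg[OF \<alpha>, of s J]
  have g: "\<bar>Zd s m k \<omega> * Sd s k \<omega> * fhat s f k\<bar> \<le> ?g k" if "k \<in> QN s n" for k
  proof (cases "k \<in> X")
    case True
    then have "Zd s m k \<omega> = 0" using bad[OF True] by (simp add: Zd_eq split: if_splits)
    then show ?thesis using True by simp
  next
    case False
    have "\<bar>fhat s f k\<bar> \<le> K2 * weight s \<alpha> J k" using fw that by (simp add: QN_def)
    then show ?thesis using False mult_nonneg_nonneg[OF less_imp_le[OF K2] w0]
      by (simp add: Zd_eq Sd_eq abs_mult)
  qed
  have "\<bar>\<Sum>k\<in>QN s n - QN s ?N. Zd s m k \<omega> * Sd s k \<omega> * fhat s f k\<bar> \<le> (\<Sum>k\<in>QN s n - QN s ?N. ?g k)"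
    by (rule order_trans[OF sum_abs sum_mono]) (use g in auto)
  also have "\<dots> = (\<Sum>k\<in>QN s N' - QN s ?N. ?g k) + (\<Sum>k\<in>QN s n - QN s N'. ?g k)"
  proof -
    have "QN s n - QN s ?N = (QN s N' - QN s ?N) \<union> (QN s n - QN s N')"
      using QN_mono[OF N, of s] QN_mono[OF n, of s] by auto
    then show ?thesis by (simp only:) (rule sum.union_disjoint, auto)
  qed
  also have "(\<Sum>k\<in>QN s N' - QN s ?N. ?g k) = (\<Sum>k\<in>QN s N' - QN s ?N - X. K2 * weight s \<alpha> J k)"
    by (rule sum.mono_neutral_cong_right) auto
  also have "\<dots> \<le> K2 * u" using mid K2 by (simp add: sum_distrib_left[symmetric])
  also have "(\<Sum>k\<in>QN s n - QN s N'. ?g k) \<le> (\<Sum>k\<in>QN s n - QN s N'. K2 * weight s \<alpha> J k)"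
    by (rule sum_mono) (use K2 w0 in auto)
  also have "\<dots> \<le> K2 * t" using tail K2 by (simp add: sum_distrib_left[symmetric])
  finally show "\<bar>\<Sum>k\<in>QN s n - QN s ?N. Zd s m k \<omega> * Sd s k \<omega> * fhat s f k\<bar> \<le> K2 * (u + t)"
    by (simp add: algebra_simps)
qed

end

text \<open>Typical vectors have at most \<open>(2 + 1 / L) * R\<close> digits per coordinate, with
  factorials of base at most \<open>4 * m\<close>. The tolerance \<open>1 / L\<close> is small
  enough that, multiplied by the logarithm \<open>L\<close>, it costs only order \<open>T\<close>.
  The number of terms, at most \<open>2 powr (2 * m)\<close>, is absorbed by the summand
  \<open>2 / a\<close>, since \<open>a * m \<le> T\<close>.\<close>

lemma sum_weight_typical_le:
  fixes s m N N' :: nat and a E L T :: real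
  assumes s: "1 \<le> s" and J: "J \<subseteq> {..<s}" and \<alpha>: "0 < \<alpha>" "\<alpha> \<le> b" "1 \<le> b"
    and m: "2 \<le> m" and L: "L = log 2 (real m)" and T: "T = sqrt (lam * real N / real s)"
    and N': "N < N'" "real N' \<le> 4 * real m ^ 2"
    and T': "sqrt (lam * real N' / real s) \<le> T + a * E"
    and a: "0 < a" "a * real m \<le> T" and E: "0 \<le> E" "E \<le> real m"
    and JE: "real (card J) * (2 * L + 7) * E \<le> real m"
    and card: "real (card (QN s N')) \<le> 2 powr (2 * real m)"
  shows "(\<Sum>k\<in>QN s N' - QN s N - atypical s N' (1 / L). weight s \<alpha> J k)
    \<le> 2 powr (- real N + (2 * real (card J) * L + (7 * real (card J) + 1 + 6 * real s * log 2 b + 2 / a)) * T)"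
proof -
  define R y where "R = sqrt (lam * real N' / real s)" and "y = (2 + 1 / L) * R"
  define q where "q = real (card J)"
  let ?X = "QN s N' - QN s N - atypical s N' (1 / L)"
  have L1: "1 \<le> L" using m by (simp add: L)
  have lb: "0 \<le> log 2 b" using \<alpha> by simp
  have R: "0 < R" using lam_bounds s N' by (simp add: R_def)
  have aE: "a * E \<le> a * real m" using a E by simp
  have RT: "R \<le> 2 * T" using T' a aE unfolding R_def by linarith
  have iL: "0 < 1 / L" "1 / L \<le> 1" using L1 by auto
  have y3: "y \<le> 3 * R" unfolding y_def using iL R by (intro mult_right_mono) auto
  have y4: "y \<le> 4 * real m"
  proof -
    have "lam * real N' / real s \<le> lam * real N'" using divide_left_mono[of 1 "real s" "lam * real N'"] s lam_bounds by simp
    also have "\<dots> \<le> (1/3) * (4 * real m ^ 2)" using lam_bounds N' by (intro mult_mono) auto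
    also have "\<dots> \<le> (4/3 * real m)^2" by (simp add: power2_eq_square)
    finally have "R \<le> 4/3 * real m" unfolding R_def by (intro real_le_lsqrt) auto
    then show ?thesis using y3 by linarith
  qed
  have w: "weight s \<alpha> J k \<le> 2 powr (- real N + y * (real s * log 2 b + q * (L + 2)))" if k: "k \<in> ?X" for k
  proof -
    have "weight s \<alpha> J k \<le> 2 powr (- real (norm1 s k) + y * (real s * log 2 b + real (card J) * log 2 (4 * real m)))"
    proof (rule weight_le_powr[OF J \<alpha>])
      fix j assume "j < s"
      then have "\<not> \<bar>real (card (kappa (k j))) / R - 2\<bar> > 1 / L"
        using k by (auto simp: atypical_def R_def)
      then have "real (card (kappa (k j))) / R \<le> 2 + 1 / L" by linarith
      then show "real (card (kappa (k j))) \<le> y" using R by (simp add: y_def pos_divide_le_eq)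
    qed (use y4 m in auto)
    also have "log 2 (4 * real m) = L + 2"
    proof -
      have "log 2 (4::real) = 2" using log_pow_cancel[of 2 2] by simp
      then show ?thesis using m by (simp add: log_mult L)
    qed
    also have "2 powr (- real (norm1 s k) + y * (real s * log 2 b + real (card J) * (L + 2)))
        \<le> 2 powr (- real N + y * (real s * log 2 b + q * (L + 2)))"
      using k by (intro powr_mono) (auto simp: QN_def q_def)
    finally show ?thesis .
  qed
  have fin: "card ?X \<le> card (QN s N')" by (rule card_mono) auto
  have "(\<Sum>k\<in>?X. weight s \<alpha> J k) \<le> real (card ?X) * 2 powr (- real N + y * (real s * log 2 b + q * (L + 2)))"
    by (rule sum_bounded_above) (rule w)
  also have "\<dots> \<le> 2 powr (2 * real m) * 2 powr (- real N + y * (real s * log 2 b + q * (L + 2)))"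
    using card fin by (intro mult_right_mono) auto
  also have "\<dots> = 2 powr (2 * real m + (- real N + y * (real s * log 2 b + q * (L + 2))))"
    by (simp only: powr_add)
  also have "\<dots> \<le> 2 powr (- real N + (2 * q * L + (7 * q + 1 + 6 * real s * log 2 b + 2 / a)) * T)"
  proof (rule powr_mono)
    have 1: "2 * real m \<le> 2 / a * T" using a by (simp add: field_simps)
    have "y * (real s * log 2 b) \<le> (6 * T) * (real s * log 2 b)"
      using y3 RT lb by (intro mult_right_mono) auto
    then have 2: "y * (real s * log 2 b) \<le> 6 * real s * log 2 b * T" by (simp add: mult_ac)
    \<comment> \<open>The leading term \<open>2 * q * L * T\<close> is the one in the claimed
      threshold. Replacing \<open>R\<close> by \<open>T\<close> costs at most
      \<open>a * m \<le> T\<close>, which is the summand 1 in the constant.\<close>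
    have 3: "y * (q * (L + 2)) \<le> (2 * q * L + 7 * q + 1) * T"
    proof -
      have "(2 + 1 / L) * (L + 2) = 2 * L + 5 + 2 * (1 / L)" using L1 by (simp add: field_simps)
      then have l7: "(2 + 1 / L) * (L + 2) \<le> 2 * L + 7" using iL by linarith
      have "y * (q * (L + 2)) = ((2 + 1 / L) * (L + 2)) * (q * R)" by (simp add: y_def mult_ac)
      also have "\<dots> \<le> (2 * L + 7) * (q * R)" using l7 R by (intro mult_right_mono) (auto simp: q_def)
      also have "\<dots> \<le> (2 * L + 7) * (q * (T + a * E))"
        using T' L1 by (intro mult_left_mono) (auto simp: q_def R_def)
      also have "\<dots> = (2 * q * L + 7 * q) * T + a * (q * (2 * L + 7) * E)" by (simp add: algebra_simps)
      also have "a * (q * (2 * L + 7) * E) \<le> a * real m" using JE a by (simp add: q_def)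
      also have "a * real m \<le> T" by (rule a)
      finally show ?thesis by (simp add: algebra_simps)
    qed
    show "2 * real m + (- real N + y * (real s * log 2 b + q * (L + 2)))
        \<le> - real N + (2 * q * L + (7 * q + 1 + 6 * real s * log 2 b + 2 / a)) * T"
      using 1 2 3 by (simp add: distrib_left distrib_right)
  qed simp
  finally show ?thesis by (simp add: q_def)
qed

text \<open>Union bound over atypical vectors: the survival probability cancels the
  \<open>2 ^ m\<close> in the size of the ball, leaving powers of \<open>m\<close>. Tolerance
  \<open>1 / L\<close> together with sqrt N' \<ge> sqrt a * m produces the exponent m / L^2.\<close>

lemma measure_atypical_le:
  fixes s m N' :: nat and a p c L :: real
  assumes s: "1 \<le> s" and AB: "AB'_hyp s A' B'" and m: "4 \<le> m" and L: "L = log 2 (real m)"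
    and N': "1 \<le> N'" "real N' \<le> 4 * real m ^ 2" "a * real m ^ 2 \<le> real N'" and a: "0 < a"
    and card: "real (card (QN s N')) \<le> real m powr p * 2 ^ (s + 2) * (c * real m * 2 ^ m)"
    and m3: "real s * A' * (4 * real m ^ 2) powr (1/4) * 2 ^ (s + 2) * c * real m \<le> real m powr 3"
  shows "measure designM (\<Union>k\<in>atypical s N' (1 / L). {\<omega>. Zd s m k \<omega> = 1})
    \<le> real m powr (3 + p) * exp (- (B' * sqrt a) * real m / L^2)"
proof -
  have AB0: "0 < A'" "0 < B'" using AB by (auto simp: AB'_hyp_def)
  \<comment> \<open>This keeps the tolerance \<open>1 / L\<close> strictly below 1, as the
    concentration hypothesis demands.\<close>
  have L2: "2 \<le> L"
  proof -
    have "log 2 (4::real) = 2" using log_pow_cancel[of 2 2] by simp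
    then show ?thesis using m log_mono[of 2 4 "real m"] by (simp add: L)
  qed
  let ?e = "exp (- (B' * sqrt a) * real m / L^2)"
  have e: "exp (- B' * (1 / L)^2 * sqrt (real N')) \<le> ?e"
  proof -
    have "sqrt a * real m \<le> sqrt (real N')"
      using real_sqrt_le_mono[OF N'(3)] by (simp add: real_sqrt_mult)
    then have "B' / L^2 * (sqrt a * real m) \<le> B' / L^2 * sqrt (real N')"
      using AB0 by (intro mult_left_mono) auto
    then show ?thesis by (simp add: power_divide mult_ac)
  qed
  have "measure designM (\<Union>k\<in>atypical s N' (1 / L). {\<omega>. Zd s m k \<omega> = 1}) \<le> real (card (atypical s N' (1 / L))) * (1/2) ^ m"
    by (rule measure_Union_Zd_le[of _ s N']) (auto simp: atypical_def)
  also have "\<dots> \<le> (real s * (A' * real N' powr (1/4) * exp (- B' * (1 / L)^2 * sqrt (real N')) * real (card (QN s N')))) * (1/2) ^ m"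
    by (rule mult_right_mono[OF card_atypical_le[OF s AB N'(1)]]) (use L2 in auto)
  also have "\<dots> \<le> (real s * (A' * (4 * real m ^ 2) powr (1/4) * ?e * (real m powr p * 2 ^ (s + 2) * (c * real m * 2 ^ m)))) * (1/2) ^ m"
    by (intro mult_right_mono mult_left_mono mult_mono e card powr_mono2) (use AB0 N' in auto)
  also have "\<dots> = (real s * A' * (4 * real m ^ 2) powr (1/4) * 2 ^ (s + 2) * c * real m) * (real m powr p * ?e)"
    by (simp add: power_one_over)
  also have "\<dots> \<le> real m powr 3 * (real m powr p * ?e)"
    by (rule mult_right_mono[OF m3]) simp
  finally show ?thesis by (simp add: powr_add)
qed

text \<open>The order of the quantifiers expresses what the constants may depend on:
  \<open>d\<close> is fixed before the cardinality of \<open>J\<close>, while \<open>D\<close> and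
  \<open>m2\<close> are fixed before \<open>J\<close> itself, \<open>K2\<close>, \<open>f\<close>
  and \<open>m\<close>. Measurability of the event is part of the claim, because
  \<open>measure\<close> is 0 on non-measurable sets.\<close>

theorem theorem4:
  fixes s :: nat and A B A' B' \<alpha> :: real
  assumes "1 \<le> s" and "AB_hyp s A B" and "AB'_hyp s A' B'" and "0 < \<alpha>"
  shows "\<exists>d::real. \<forall>Jc::nat. \<exists>(D::real) (m2::nat).
    \<forall>(J::nat set) (K2::real) (f::(nat \<Rightarrow> real) \<Rightarrow> real) (m::nat).
      J \<subseteq> {..<s} \<and> J \<noteq> {} \<and> card J = Jc \<and> 0 < K2 \<and> smooth_cube s f \<and>
      (\<forall>k\<in>vecs s. (\<integral>\<^sup>+ x. ennreal \<bar>mixed s (\<lambda>j. card (kappa (k j))) f x\<bar> \<partial>cubeM s)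
          \<le> ennreal (K2 * \<alpha> ^ norm0 s k * (\<Prod>j\<in>J. fact (card (kappa (k j)))))) \<and>
      m2 \<le> m \<longrightarrow>
      (let E = {\<omega> \<in> space designM.
                 \<bar>SUM2 s B m f \<omega>\<bar> \<ge> K2 * 2 powr (- real (Nm s B m)
                    + (2 * real (card J) * log 2 (real m) + D) * sqrt (lam * real (Nm s B m) / real s))}
       in E \<in> sets designM \<and>
          measure designM E \<le> real m powr d
             * exp (- (B' * sqrt (lam / (2 * real s))) * real m / (log 2 (real m))^2))"
proof -
  note s = assms(1) and AB = assms(3)
  have B: "0 < B" using assms(2) by (simp add: AB_hyp_def)
  have A': "0 < A'" using AB by (simp add: AB'_hyp_def)
  define a C c b p where "a = lam / (2 * real s)" and "C = 24 * real s / a" and "c = c_s s B"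
    and "b = max 1 \<alpha>" and "p = (real s + 2) * C"
  have a0: "0 < a" using s lam_bounds by (simp add: a_def)
  have C0: "0 < C" using s a0 by (simp add: C_def)
  have c0: "0 < c" using s B lam_bounds by (simp add: c_def c_s_def)
  have b: "\<alpha> \<le> b" "1 \<le> b" by (auto simp: b_def)
  \<comment> \<open>With \<open>m\<close> quantified before \<open>J\<close>, \<open>K2\<close> and
    \<open>f\<close>, all asymptotic conditions can be intersected into a single threshold. The
    exponent \<open>3 + p\<close> does not involve \<open>Jc\<close>.\<close>
  have "\<exists>(D::real) (m2::nat). \<forall>m\<ge>m2. \<forall>(J::nat set) (K2::real) (f::(nat \<Rightarrow> real) \<Rightarrow> real).
      J \<subseteq> {..<s} \<and> card J = Jc \<and> 0 < K2 \<and> smooth_cube s f \<and>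
      (\<forall>k\<in>vecs s. (\<integral>\<^sup>+ x. ennreal \<bar>mixed s (\<lambda>j. card (kappa (k j))) f x\<bar> \<partial>cubeM s)
          \<le> ennreal (K2 * \<alpha> ^ norm0 s k * (\<Prod>j\<in>J. fact (card (kappa (k j)))))) \<longrightarrow>
      (let E = {\<omega> \<in> space designM.
                 \<bar>SUM2 s B m f \<omega>\<bar> \<ge> K2 * 2 powr (- real (Nm s B m)
                    + (2 * real (card J) * log 2 (real m) + D) * sqrt (lam * real (Nm s B m) / real s))}
       in E \<in> sets designM \<and>
          measure designM E \<le> real m powr (3 + p) * exp (- (B' * sqrt a) * real m / (log 2 (real m))^2))"
    for Jc
  proof -
    define D0 where "D0 = 7 * real Jc + 1 + 6 * real s * log 2 b + 2 / a"
    have D0: "0 \<le> D0" using a0 b by (simp add: D0_def)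
    note enlarged_radius[OF s AB B a_def C_def]
    moreover note tail_exponent_eventually[OF s, of "log 2 b + 3"]
    moreover have "eventually (\<lambda>m::nat. 4 \<le> a * real m) sequentially" using a0 by real_asymp
    moreover have "eventually (\<lambda>m::nat. C * log 2 (real m) + 1 \<le> real m) sequentially" using C0 by real_asymp
    moreover have "eventually (\<lambda>m::nat. real Jc * (2 * log 2 (real m) + 7) * (C * log 2 (real m) + 1) \<le> real m) sequentially"
      using C0 by real_asymp
    moreover have "eventually (\<lambda>m::nat. real m powr p * 2 ^ (s + 2) * (c * real m) \<le> 2 ^ m) sequentially"
      using c0 by real_asymp
    moreover have "eventually (\<lambda>m::nat. real s * A' * (4 * real m ^ 2) powr (1/4) * 2 ^ (s + 2) * c * real m \<le> real m powr 3) sequentially"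
      using c0 A' s by real_asymp
    moreover have "eventually (\<lambda>m::nat. 4 \<le> m) sequentially" by (rule eventually_ge_at_top)
    ultimately have "eventually (\<lambda>m. \<forall>(J::nat set) (K2::real) (f::(nat \<Rightarrow> real) \<Rightarrow> real).
      J \<subseteq> {..<s} \<and> card J = Jc \<and> 0 < K2 \<and> smooth_cube s f \<and>
      (\<forall>k\<in>vecs s. (\<integral>\<^sup>+ x. ennreal \<bar>mixed s (\<lambda>j. card (kappa (k j))) f x\<bar> \<partial>cubeM s)
          \<le> ennreal (K2 * \<alpha> ^ norm0 s k * (\<Prod>j\<in>J. fact (card (kappa (k j)))))) \<longrightarrow>
      (let E = {\<omega> \<in> space designM.
                 \<bar>SUM2 s B m f \<omega>\<bar> \<ge> K2 * 2 powr (- real (Nm s B m)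
                    + (2 * real (card J) * log 2 (real m) + (D0 + 1)) * sqrt (lam * real (Nm s B m) / real s))}
       in E \<in> sets designM \<and>
          measure designM E \<le> real m powr (3 + p) * exp (- (B' * sqrt a) * real m / (log 2 (real m))^2))) sequentially"
    proof eventually_elim
      case (elim m)
      define N L T where "N = Nm s B m" and "L = log 2 (real m)" and "T = sqrt (lam * real N / real s)"
      from elim(1) obtain N' where N': "N < N'" "real N' \<le> 4 * real m ^ 2" "a * real m ^ 2 \<le> real N'"
        "12 * real s * real m * L \<le> real N' - real N"
        and cardN': "real (card (QN s N')) \<le> 2 powr ((real s + 2) * (C * L + 1)) * (c * real m * 2 ^ m)"
        and T': "sqrt (lam * real N' / real s) \<le> T + a * (C * L + 1)"
        and aT: "a * real m \<le> T" and N3: "N \<le> 3 * m^2"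
        unfolding N_def T_def L_def c_def by blast
      have L1: "1 \<le> L" using elim(8) by (simp add: L_def)
      \<comment> \<open>The growth factor of the enlarged ball is a fixed power of \<open>m\<close>
        up to a constant.\<close>
      have "2 powr ((real s + 2) * (C * L + 1)) = real m powr p * 2 ^ (s + 2)"
      proof -
        have "real m = 2 powr L" using elim(8) by (simp add: L_def)
        then have "real m powr p = 2 powr (L * p)" by (simp add: powr_powr)
        moreover have "(2::real) ^ (s + 2) = 2 powr (real s + 2)" by (simp add: powr_add powr_realpow)
        ultimately show ?thesis by (simp only: powr_add[symmetric]) (simp add: p_def algebra_simps)
      qed
      with cardN' have cardN': "real (card (QN s N')) \<le> real m powr p * 2 ^ (s + 2) * (c * real m * 2 ^ m)"
        by simp
      also have "\<dots> = (real m powr p * 2 ^ (s + 2) * (c * real m)) * 2 ^ m" by simp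
      also have "\<dots> \<le> 2 ^ m * 2 ^ m" by (rule mult_right_mono[OF elim(6)]) simp
      also have "\<dots> = 2 powr (2 * real m)" by (simp add: powr_realpow[symmetric] powr_add[symmetric])
      finally have card2m: "real (card (QN s N')) \<le> 2 powr (2 * real m)" .
      have tailM: "real s * sqrt (2 * real M) * (log 2 b + 3 + log 2 (sqrt (2 * real M))) \<le> (real M - real N) / 2"
        if "N' < M" for M
        using elim(2)[rule_format, of N M] N3 N' that unfolding L_def by linarith
      show ?case
      proof (intro allI impI)
        fix J :: "nat set" and K2 :: real and f :: "(nat \<Rightarrow> real) \<Rightarrow> real"
        assume H: "J \<subseteq> {..<s} \<and> card J = Jc \<and> 0 < K2 \<and> smooth_cube s f \<and>
          (\<forall>k\<in>vecs s. (\<integral>\<^sup>+ x. ennreal \<bar>mixed s (\<lambda>j. card (kappa (k j))) f x\<bar> \<partial>cubeM s)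
            \<le> ennreal (K2 * \<alpha> ^ norm0 s k * (\<Prod>j\<in>J. fact (card (kappa (k j))))))"
        then have J: "J \<subseteq> {..<s}" and Jc: "card J = Jc" and K2: "0 < K2" and f: "smooth_cube s f" by auto
        have fw: "\<bar>fhat s f k\<bar> \<le> K2 * weight s \<alpha> J k" if "k \<in> vecs s" for k
          by (rule fhat_le_weight[OF f that assms(4) K2]) (use H in blast)
        define e where "e = (2 * real Jc * L + D0) * T"
        define thr where "thr = 2 powr (- real N + (2 * real (card J) * L + (D0 + 1)) * T)"
        let ?bad = "atypical s N' (1 / L)"
        have tail: "(\<Sum>k\<in>QN s n - QN s N'. weight s \<alpha> J k) \<le> 4 * 2 powr (- real N)" for n
          by (rule sum_weight_tail_le[OF s J assms(4) b _ tailM]) (use N' in auto)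
        have mid: "(\<Sum>k\<in>QN s N' - QN s N - ?bad. weight s \<alpha> J k) \<le> 2 powr (- real N + e)"
          using sum_weight_typical_le[OF s J assms(4) b _ L_def T_def N'(1,2) T' a0 aT _ _ _ card2m]
            elim(4,5,8) C0 L1 by (simp add: Jc e_def D0_def L_def)
        have T4: "4 \<le> T" using aT elim(3) by linarith
        have e0: "0 \<le> e" using T4 L1 D0 by (simp add: e_def)
        \<comment> \<open>Raising the constant from \<open>D0\<close> to \<open>D0 + 1\<close> gains
          the factor \<open>2 powr T\<close>, at least 16, which leaves room for the tail
          \<open>4 * 2 powr (- N)\<close>. Strictness matters because the event is defined by a
          non-strict inequality.\<close>
        have small: "2 powr (- real N + e) + 4 * 2 powr (- real N) < thr"
        proof -
          have "thr = 2 powr (- real N) * 2 powr e * 2 powr T"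
            by (simp add: thr_def e_def Jc powr_add[symmetric] algebra_simps)
          moreover have "2 powr (4::real) \<le> 2 powr T" using T4 by (intro powr_mono) auto
          moreover have "2 powr (0::real) \<le> 2 powr e" using e0 by (intro powr_mono) auto
          moreover have "(2::real) powr 4 = 16" by (simp add: powr_numeral)
          ultimately have "2 powr (- real N) * 2 powr e * 16 \<le> thr" "1 \<le> 2 powr e" by auto
          moreover have "2 powr (- real N) * (2 powr e + 4) < 2 powr (- real N) * (2 powr e * 16)"
            using \<open>1 \<le> 2 powr e\<close> by (intro mult_strict_left_mono) auto
          moreover have "2 powr (- real N + e) + 4 * 2 powr (- real N) = 2 powr (- real N) * (2 powr e + 4)"
            by (simp only: powr_add) (simp add: algebra_simps)
          ultimately show ?thesis by (simp only: mult.assoc)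
        qed
        define E where "E = {\<omega> \<in> space designM. \<bar>SUM2 s B m f \<omega>\<bar> \<ge> K2 * thr}"
        have [measurable]: "SUM2 s B m f \<in> borel_measurable designM"
          by (rule SUM2_measurable[OF assms(4) K2 fw tail])
        have Es: "E \<in> sets designM" unfolding E_def by measurable
        \<comment> \<open>If no atypical vector survives, the deterministic bounds keep the sum
          strictly below the threshold.\<close>
        have sub: "E \<subseteq> (\<Union>k\<in>?bad. {\<omega>. Zd s m k \<omega> = 1})"
        proof (rule subsetI, rule ccontr)
          fix \<omega> assume w: "\<omega> \<in> E" and nb: "\<omega> \<notin> (\<Union>k\<in>?bad. {\<omega>. Zd s m k \<omega> = 1})"
          have "\<bar>SUM2 s B m f \<omega>\<bar> \<le> K2 * (2 powr (- real N + e) + 4 * 2 powr (- real N))"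
            by (rule abs_SUM2_le[OF assms(4) K2 fw tail, where X="?bad"]) (use N' nb mid in \<open>auto simp: N_def\<close>)
          also have "\<dots> < K2 * thr" using small K2 by simp
          finally show False using w by (simp add: E_def)
        qed
        have Us: "(\<Union>k\<in>?bad. {\<omega>. Zd s m k \<omega> = 1}) \<in> sets designM"
        proof (rule sets.finite_UN)
          show "finite ?bad" by (rule finite_subset[OF _ finite_QN[of s N']]) (auto simp: atypical_def)
          fix k
          have "Measurable.pred designM (\<lambda>\<omega>. Zd s m k \<omega> = 1)" by measurable
          then show "{\<omega>. Zd s m k \<omega> = 1} \<in> sets designM" by (simp add: pred_def)
        qed
        interpret prob_space designM by (rule prob_space_designM)
        have "measure designM E \<le> measure designM (\<Union>k\<in>?bad. {\<omega>. Zd s m k \<omega> = 1})"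
          by (rule finite_measure_mono[OF sub Us])
        also have "\<dots> \<le> real m powr (3 + p) * exp (- (B' * sqrt a) * real m / L^2)"
          by (rule measure_atypical_le[OF s AB elim(8) L_def _ N'(2,3) a0 cardN' elim(7)]) (use N' in auto)
        finally show "let E = {\<omega> \<in> space designM.
                 \<bar>SUM2 s B m f \<omega>\<bar> \<ge> K2 * 2 powr (- real (Nm s B m)
                    + (2 * real (card J) * log 2 (real m) + (D0 + 1)) * sqrt (lam * real (Nm s B m) / real s))}
           in E \<in> sets designM \<and>
            measure designM E \<le> real m powr (3 + p) * exp (- (B' * sqrt a) * real m / (log 2 (real m))^2)"
          using Es unfolding E_def thr_def N_def L_def T_def Let_def by blast
      qed
    qed
    then show ?thesis unfolding eventually_sequentially by blast
  qed
  then show ?thesis unfolding a_def by (intro exI[of _ "3 + p"]) meson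
qed

end
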